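(* Let $k\ge1$, $m=2k$, $n\ge1$, $1\le l\le m-1$, and let $q$ be a nonzero complex number with $q^{8\binom{k}{2}}=1$. In the quantum matrix algebra $M_q(mn+l)$, extend the generator matrix $(a_{ij})_{1\le i,j\le mn+l}$ to an $m(n+1)\times m(n+1)$ matrix by setting, for $l<i\le m$: $a_{mn+i,j}=a_{j,mn+i}=0$ for all $j\ne mn+i$, and $a_{mn+i,mn+i}=1$. For $1\le i_1<\cdots<i_m\le m(n+1)$ put $$[i_1,i_2,\dots,i_m]_m=b_{i_1,i_2,\dots,i_m}=\sum_{i=1}^{n+1}\xi^{m(i-1)+1,\dots,mi}_{i_1,\dots,i_m},$$ the quantum minors being those of the extended matrix. Then the quantum determinant of order $mn+l$ is a quantum hyper-Pfaffian of order $n+1$: $${\det}_q(a_{ij})_{1\le i,j\le mn+l}=[1,2,\dots,m(n+1)-1,m(n+1)]_m.$$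
   Context: $M_q(N)$ is the unital associative complex algebra generated by $a_{ij}$, $1\le i,j\le N$, subject to the relations, for all $i<j$ and $k<l$: $a_{ik}a_{il}=qa_{il}a_{ik}$, $a_{ik}a_{jk}=qa_{jk}a_{ik}$, $a_{jk}a_{il}=a_{il}a_{jk}$, $a_{ik}a_{jl}-a_{jl}a_{ik}=(q-q^{-1})a_{il}a_{jk}$. For a matrix $(a_{ij})$ with entries in an algebra and $i_1<\cdots<i_s$, $j_1<\cdots<j_s$, the quantum minor (rows on top, columns below) is $\xi^{i_1,\dots,i_s}_{j_1,\dots,j_s}=\sum_{\sigma\in S_s}(-q)^{l(\sigma)}a_{i_1,j_{\sigma(1)}}\cdots a_{i_s,j_{\sigma(s)}}$, with $l(\sigma)$ the number of inversions; ${\det}_q(a_{ij})_{1\le i,j\le N}=\xi^{1,\dots,N}_{1,\dots,N}$. Quantum hyper-Pfaffian of order $n+1$: given elements $b_{i_1,\dots,i_m}$ ($1\le i_1<\cdots<i_m\le m(n+1)$) of an associative algebra, put $[i_1,\dots,i_m]_m=b_{i_1,\dots,i_m}$ and, for $s_1<\cdots<s_{mp}$ in $\{1,\dots,m(n+1)\}$ with $p\ge 2$, inductively $$[s_1,\dots,s_{mp}]_m=\sum_{1<j_2<\cdots<j_m\le mp}(-q)^{\sum_{t=2}^m(j_t-t)}[s_1,s_{j_2},\dots,s_{j_m}]_m\,[s_2,\dots,\widehat{s_{j_2}},\dots,\widehat{s_{j_m}},\dots,s_{mp}]_m$$ (hats mean omitted entries). The quantum hyper-Pfaffian is $[1,2,\dots,m(n+1)]_m$.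 *)

theory Defs
  imports Complex_Main "HOL-Combinatorics.Permutations" "HOL-Algebra.QuotRing" "HOL-Algebra.Module"
begin

text \<open>
  A complex algebra is represented by a record of type \<open>(complex, 'a) module\<close>, which carries a
  (possibly noncommutative) ring structure together with a scalar multiplication.
\<close>

section \<open>Free algebras and their quotients\<close>

text \<open>
  An element of the free algebra on \<open>X\<close> is the coefficient function of a finite linear
  combination of words over \<open>X\<close>; the product is convolution with respect to concatenation.
\<close>

definition free_algebra :: "'x set \<Rightarrow> (complex, 'x list \<Rightarrow> complex) module" where
  "free_algebra X =
    \<lparr>carrier = {f. finite {w. f w \<noteq> 0} \<and> (\<forall>w. f w \<noteq> 0 \<longrightarrow> set w \<subseteq> X)},
     mult = (\<lambda>f g w. \<Sum>i\<le>length w. f (take i w) * g (drop i w)),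
     one = (\<lambda>w. if w = [] then 1 else 0),
     zero = (\<lambda>w. 0),
     add = (\<lambda>f g w. f w + g w),
     smult = (\<lambda>c f w. c * f w)\<rparr>"

definition free_gen :: "'x \<Rightarrow> 'x list \<Rightarrow> complex" where
  "free_gen x = (\<lambda>w. if w = [x] then 1 else 0)"

text \<open>The scalar multiplication follows the pattern of \<^const>\<open>rcoset_mult\<close>.\<close>

definition quot_algebra :: "(complex, 'a) module \<Rightarrow> 'a set \<Rightarrow> (complex, 'a set) module" where
  "quot_algebra A I =
    ring.extend (A Quot I)
      (module.fields (\<lambda>c C. \<Union>x\<in>C. I +>\<^bsub>A\<^esub> (c \<odot>\<^bsub>A\<^esub> x)))"


section \<open>The quantum matrix algebra\<close>

text \<open>
  The first relation is required for every row \<open>i\<close> and the second for every column \<open>k\<close>,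
  including the last one, not only for those indices that have a larger companion.
\<close>

definition qmat_rels :: "complex \<Rightarrow> nat \<Rightarrow> ((nat \<times> nat) list \<Rightarrow> complex) set" where
  "qmat_rels q N =
    (let F = free_algebra ({1..N} \<times> {1..N}); a = (\<lambda>i j. free_gen (i, j)) in
      {a i k \<otimes>\<^bsub>F\<^esub> a i l \<ominus>\<^bsub>F\<^esub> q \<odot>\<^bsub>F\<^esub> (a i l \<otimes>\<^bsub>F\<^esub> a i k)
        | i k l. 1 \<le> i \<and> i \<le> N \<and> 1 \<le> k \<and> k < l \<and> l \<le> N} \<union>
      {a i k \<otimes>\<^bsub>F\<^esub> a j k \<ominus>\<^bsub>F\<^esub> q \<odot>\<^bsub>F\<^esub> (a j k \<otimes>\<^bsub>F\<^esub> a i k)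
        | i j k. 1 \<le> i \<and> i < j \<and> j \<le> N \<and> 1 \<le> k \<and> k \<le> N} \<union>
      {a j k \<otimes>\<^bsub>F\<^esub> a i l \<ominus>\<^bsub>F\<^esub> a i l \<otimes>\<^bsub>F\<^esub> a j k
        | i j k l. 1 \<le> i \<and> i < j \<and> j \<le> N \<and> 1 \<le> k \<and> k < l \<and> l \<le> N} \<union>
      {(a i k \<otimes>\<^bsub>F\<^esub> a j l \<ominus>\<^bsub>F\<^esub> a j l \<otimes>\<^bsub>F\<^esub> a i k)
          \<ominus>\<^bsub>F\<^esub> (q - inverse q) \<odot>\<^bsub>F\<^esub> (a i l \<otimes>\<^bsub>F\<^esub> a j k)
        | i j k l. 1 \<le> i \<and> i < j \<and> j \<le> N \<and> 1 \<le> k \<and> k < l \<and> l \<le> N})"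

text \<open>
  Scalar multiples in \<^const>\<open>free_algebra\<close> are products with multiples of the unit, so the ring
  ideal generated by the relations is also the algebra ideal generated by them.
\<close>

definition qmat_ideal :: "complex \<Rightarrow> nat \<Rightarrow> ((nat \<times> nat) list \<Rightarrow> complex) set" where
  "qmat_ideal q N = Idl\<^bsub>free_algebra ({1..N} \<times> {1..N})\<^esub> (qmat_rels q N)"

definition qmat_algebra ::
    "complex \<Rightarrow> nat \<Rightarrow> (complex, ((nat \<times> nat) list \<Rightarrow> complex) set) module" where
  "qmat_algebra q N = quot_algebra (free_algebra ({1..N} \<times> {1..N})) (qmat_ideal q N)"

definition qmat_gen ::
    "complex \<Rightarrow> nat \<Rightarrow> nat \<Rightarrow> nat \<Rightarrow> ((nat \<times> nat) list \<Rightarrow> complex) set" where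
  "qmat_gen q N i j = qmat_ideal q N +>\<^bsub>free_algebra ({1..N} \<times> {1..N})\<^esub> free_gen (i, j)"


section \<open>Quantum minors and the quantum hyper-Pfaffian\<close>

definition inversions :: "nat \<Rightarrow> (nat \<Rightarrow> nat) \<Rightarrow> nat" where
  "inversions s \<sigma> = card {(r, t). r < t \<and> t < s \<and> \<sigma> t < \<sigma> r}"

text \<open>
  \<open>I\<close> and \<open>J\<close> are strictly increasing lists of the same length, of row and column indices
  respectively. The factors are multiplied in the order of the rows.
\<close>

definition qminor ::
    "(complex, 'a) module \<Rightarrow> complex \<Rightarrow> (nat \<Rightarrow> nat \<Rightarrow> 'a) \<Rightarrow> nat list \<Rightarrow> nat list \<Rightarrow> 'a" where
  "qminor A q a I J =
    (\<Oplus>\<^bsub>A\<^esub>\<sigma>\<in>{\<sigma>. \<sigma> permutes {..<length I}}.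
      (- q) ^ inversions (length I) \<sigma> \<odot>\<^bsub>A\<^esub>
        foldr (\<otimes>\<^bsub>A\<^esub>) (map (\<lambda>r. a (I ! r) (J ! \<sigma> r)) [0..<length I]) \<one>\<^bsub>A\<^esub>)"

definition qdet :: "(complex, 'a) module \<Rightarrow> complex \<Rightarrow> (nat \<Rightarrow> nat \<Rightarrow> 'a) \<Rightarrow> nat \<Rightarrow> 'a" where
  "qdet A q a N = qminor A q a [1..<N + 1] [1..<N + 1]"

text \<open>
  \<open>hyper_bracket A q m b n S\<close> is the bracket $[s_1, \ldots, s_{m(n+1)}]_m$ for the strictly increasing
  list \<open>S\<close> $= (s_1, \ldots, s_{m(n+1)})$. The summation index \<open>J\<close> is the set
  $\{j_2 < \cdots < j_m\}$ of 1-based positions, whereas \<^const>\<open>nths\<close> counts from 0. Since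
  $j_t \geq t$, the natural number subtraction does not truncate.
\<close>

primrec hyper_bracket ::
    "(complex, 'a) module \<Rightarrow> complex \<Rightarrow> nat \<Rightarrow> (nat list \<Rightarrow> 'a) \<Rightarrow> nat \<Rightarrow> nat list \<Rightarrow> 'a" where
  "hyper_bracket A q m b 0 S = b S"
| "hyper_bracket A q m b (Suc n) S =
    (\<Oplus>\<^bsub>A\<^esub>J\<in>{J. J \<subseteq> {2..length S} \<and> card J = m - 1}.
      (- q) ^ (\<Sum>J - \<Sum>{2..m}) \<odot>\<^bsub>A\<^esub>
        (b (nths S {i. i + 1 \<in> insert 1 J}) \<otimes>\<^bsub>A\<^esub>
         hyper_bracket A q m b n (nths S {i. i + 1 \<notin> insert 1 J})))"

text \<open>The quantum hyper-Pfaffian of order \<open>n + 1\<close>.\<close>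

definition hyper_pfaffian ::
    "(complex, 'a) module \<Rightarrow> complex \<Rightarrow> nat \<Rightarrow> (nat list \<Rightarrow> 'a) \<Rightarrow> nat \<Rightarrow> 'a" where
  "hyper_pfaffian A q m b n = hyper_bracket A q m b n [1..<m * (n + 1) + 1]"

text \<open>The block diagonal extension of an \<open>N \<times> N\<close> matrix by an identity matrix.\<close>

definition extend_matrix ::
    "(complex, 'a) module \<Rightarrow> nat \<Rightarrow> (nat \<Rightarrow> nat \<Rightarrow> 'a) \<Rightarrow> nat \<Rightarrow> nat \<Rightarrow> 'a" where
  "extend_matrix A N a i j =
    (if i \<le> N \<and> j \<le> N then a i j else if i = j then \<one>\<^bsub>A\<^esub> else \<zero>\<^bsub>A\<^esub>)"

definition block_minor_sum ::
    "(complex, 'a) module \<Rightarrow> complex \<Rightarrow> (nat \<Rightarrow> nat \<Rightarrow> 'a) \<Rightarrow> nat \<Rightarrow> nat \<Rightarrow> nat list \<Rightarrow> 'a" where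
  "block_minor_sum A q a m n J =
    (\<Oplus>\<^bsub>A\<^esub>i\<in>{1..n + 1}. qminor A q a [m * (i - 1) + 1..<m * i + 1] J)"

end

theory Submission
  imports Defs "HOL-Combinatorics.Multiset_Permutations"
begin

text \<open>
  Let $x_1, \ldots, x_M$, $M = m(n+1)$, generate the \<open>q\<close>-exterior algebra, put
  $\omega_i = \sum_j a_{ij} x_j$ and let $\Omega_i$ be the product of the \<open>i\<close>-th block of \<open>m\<close>
  consecutive $\omega$'s. Then $\Omega = \sum_i \Omega_i$ has the coefficients $b_I$, and the product
  of all $\Omega_i$ is the determinant of the extended matrix times $x_1 \cdots x_M$. By induction,
  the bracket $[S]_m$ with $|S| = mp$ is the coefficient at \<open>S\<close> of the \<open>p\<close>-th elementary symmetric
  function $E_p$ of the $\Omega_i$ (factors in increasing order).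

  For the inductive step let $s = \min S$, discard the generators before $x_s$ and split
  $\Omega_i = y_i + \beta_i$, where $y_i$ collects the terms that contain $x_s$. Then
  $y_i \beta_i = 0$, $y_i y_j = 0$, and $\beta_i y_j = y_j \beta_i$ for $i < j$; the last relation is
  the only one that needs the root of unity condition, in the form $q^{m(m-2)} = 1$. Hence
  $E_{p+1}(\Omega) = (\sum_i y_i)\, E_p(\beta) + E_{p+1}(\beta)$, and the coefficient at \<open>S\<close> of the
  first summand is the defining sum of the bracket.
\<close>

section \<open>The \<open>q\<close>-exterior algebra\<close>

text \<open>The root of unity condition comes from counting exchanges. Write y_j = x_s z_j, where
  each term of z_j has one matrix entry and m - 1 linear forms. For i < j, moving x_s to the left
  through beta_i costs (-q)^m, while moving z_j to the right through beta_i costs (-q)^(m(m-1)).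
  Hence beta_i y_j and y_j beta_i agree as soon as (-q)^(m(m-2)) = 1, and for m = 2k the exponent
  m(m-2) is 4k(k-1) = 8 binom(k,2).

  The order of the blocks matters. The entry a_js commutes with a_il when i < j and s < l, but with
  the rows exchanged the commutator is a correction term. So beta_i is moved only past a later y_j,
  and this suffices: in the ordered products of E_p, everything to the left of y_j comes from
  earlier blocks.

  The entries do not commute, so they are coefficients of the exterior algebra and commute only with
  its generators. The calculation takes place in a type class; finite matrices are padded with
  zeros, which lets their relations hold for all indices.\<close>

text \<open>The constant \<open>qp\<close> stands for $-q$.\<close>

class q_ring = ring + monoid_mult +
  fixes qp qp_inv :: 'a
  assumes qp_commute: "qp * x = x * qp"
    and qp_inverse: "qp * qp_inv = 1"

lemma qp_power_commute: "x * qp ^ n = qp ^ n * (x :: 'a :: q_ring)"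
proof (induction n)
  case (Suc n)
  have "x * qp ^ Suc n = (x * qp) * qp ^ n"
    by (simp add: mult.assoc)
  also have "\<dots> = qp * (x * qp ^ n)"
    by (simp only: qp_commute[symmetric] mult.assoc)
  finally show ?case
    using Suc by (simp add: mult.assoc)
qed simp

lemma qp_power_left_commute: "x * (qp ^ n * y) = qp ^ n * (x * (y :: 'a :: q_ring))"
  by (simp only: mult.assoc[symmetric] qp_power_commute[of x])

lemma qp_power_swap: "qp ^ m * (qp ^ n * x) = qp ^ (m + n) * (x :: 'a :: q_ring)"
  by (simp add: power_add mult.assoc)

text \<open>For disjoint \<open>I\<close> and \<open>J\<close> this is the number of neighbour
  exchanges that sort the increasing word of \<open>I\<close> followed by that of \<open>J\<close>.
  Each exchange gives a factor -q, so this is the exponent in a product of two monomials.\<close>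

definition crossings :: "nat set \<Rightarrow> nat set \<Rightarrow> nat" where
  "crossings I J = card {(i, j). i \<in> I \<and> j \<in> J \<and> j < i}"

lemma finite_crossings: "finite I \<Longrightarrow> finite J \<Longrightarrow> finite {(i, j). i \<in> I \<and> j \<in> J \<and> j < (i::nat)}"
  by (rule finite_subset[of _ "I \<times> J"]) auto

lemma crossings_Un_right:
  assumes "finite I" "finite J" "finite K" "J \<inter> K = {}"
  shows "crossings I (J \<union> K) = crossings I J + crossings I K"
proof -
  have "{(i, j). i \<in> I \<and> j \<in> J \<union> K \<and> j < i} =
      {(i, j). i \<in> I \<and> j \<in> J \<and> j < i} \<union> {(i, j). i \<in> I \<and> j \<in> K \<and> j < i}" by auto
  then show ?thesis
    unfolding crossings_def using assms
    by (simp only:) (intro card_Un_disjoint finite_crossings, auto)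
qed

lemma crossings_Un_left:
  assumes "finite I" "finite J" "finite K" "I \<inter> J = {}"
  shows "crossings (I \<union> J) K = crossings I K + crossings J K"
proof -
  have "{(i, j). i \<in> I \<union> J \<and> j \<in> K \<and> j < i} =
      {(i, j). i \<in> I \<and> j \<in> K \<and> j < i} \<union> {(i, j). i \<in> J \<and> j \<in> K \<and> j < i}" by auto
  then show ?thesis
    unfolding crossings_def using assms
    by (simp only:) (intro card_Un_disjoint finite_crossings, auto)
qed

lemma crossings_empty [simp]: "crossings {} J = 0" "crossings I {} = 0"
  by (auto simp: crossings_def)

lemma crossings_singleton_left: "crossings {j} S = card {k \<in> S. k < j}"
proof -
  have "{(i, k). i \<in> {j} \<and> k \<in> S \<and> k < i} = Pair j ` {k \<in> S. k < j}" by auto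
  then show ?thesis by (simp add: crossings_def card_image inj_on_def)
qed

lemma crossings_singleton_right: "crossings S {j} = card {k \<in> S. j < k}"
proof -
  have "{(i, k). i \<in> S \<and> k \<in> {j} \<and> k < i} = (\<lambda>i. (i, j)) ` {k \<in> S. j < k}" by auto
  then show ?thesis by (simp add: crossings_def card_image inj_on_def)
qed

text \<open>
  The \<open>q\<close>-exterior algebra with coefficients in \<open>'a\<close>: the function \<open>f\<close> stands for
  $\sum_S f(S)\, x_{s_1} \cdots x_{s_r}$, where $S = \{s_1 < \cdots < s_r\}$; the generators
  satisfy $x_j x_i = -q\, x_i x_j$ for $i < j$.
\<close>

typedef (overloaded) 'a ext = "{f :: nat set \<Rightarrow> 'a :: zero. \<forall>S. infinite S \<longrightarrow> f S = 0}"
  morphisms coeff Abs_ext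
  by (intro exI[of _ "\<lambda>_. 0"]) simp

setup_lifting type_definition_ext

lemma coeff_infinite: "infinite S \<Longrightarrow> coeff x S = 0"
  using coeff[of x] by simp

lemma ext_eqI:
  assumes "\<And>S. finite S \<Longrightarrow> coeff x S = coeff y S"
  shows "x = y"
proof -
  have "coeff x S = coeff y S" for S
    using assms[of S] by (cases "finite S") (simp_all add: coeff_infinite)
  then show ?thesis
    by (simp add: coeff_inject[symmetric] fun_eq_iff)
qed

instantiation ext :: (q_ring) "{ring, monoid_mult}"
begin

lift_definition zero_ext :: "'a ext" is "\<lambda>S. 0" by simp
lift_definition one_ext :: "'a ext" is "\<lambda>S. if S = {} then 1 else 0" by auto
lift_definition plus_ext :: "'a ext \<Rightarrow> 'a ext \<Rightarrow> 'a ext" is "\<lambda>f g S. f S + g S" by simp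
lift_definition minus_ext :: "'a ext \<Rightarrow> 'a ext \<Rightarrow> 'a ext" is "\<lambda>f g S. f S - g S" by simp
lift_definition uminus_ext :: "'a ext \<Rightarrow> 'a ext" is "\<lambda>f S. - f S" by simp
lift_definition times_ext :: "'a ext \<Rightarrow> 'a ext \<Rightarrow> 'a ext" is
  "\<lambda>f g S. \<Sum>I\<in>Pow S. qp ^ crossings I (S - I) * (f I * g (S - I))"
  by (simp add: finite_Pow_iff)

lemmas coeff_simps = zero_ext.rep_eq one_ext.rep_eq plus_ext.rep_eq minus_ext.rep_eq
  uminus_ext.rep_eq times_ext.rep_eq

instance
proof
  fix x y z :: "'a ext"
  show "x * y * z = x * (y * z)"
  proof (rule ext_eqI)
    fix S :: "nat set" assume "finite S"
    \<comment> \<open>Both bracketings become the sum of \<open>T I J K\<close> over the ordered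
      splittings of \<open>S\<close> into three parts; the exponent treats the three pairs of parts
      alike.\<close>
    define T where "T I J K = qp ^ (crossings I J + crossings I K + crossings J K) *
      (coeff x I * (coeff y J * coeff z K))" for I J K
    have "coeff (x * y * z) S = (\<Sum>K\<in>Pow S. \<Sum>I\<in>Pow K. qp ^ crossings K (S - K) *
        (qp ^ crossings I (K - I) * (coeff x I * coeff y (K - I)) * coeff z (S - K)))"
      by (simp add: times_ext.rep_eq sum_distrib_left sum_distrib_right)
    also have "\<dots> = (\<Sum>K\<in>Pow S. \<Sum>I\<in>Pow K. T I (K - I) (S - K))"
    proof (intro sum.cong refl)
      fix K I assume "K \<in> Pow S" "I \<in> Pow K"
      then have "K = I \<union> (K - I)" by auto
      moreover have "crossings (I \<union> (K - I)) (S - K) = crossings I (S - K) + crossings (K - I) (S - K)"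
        using \<open>finite S\<close> \<open>K \<in> Pow S\<close> \<open>I \<in> Pow K\<close>
        by (intro crossings_Un_left) (auto intro: finite_subset)
      ultimately have "crossings K (S - K) = crossings I (S - K) + crossings (K - I) (S - K)"
        by metis
      then show "qp ^ crossings K (S - K) *
        (qp ^ crossings I (K - I) * (coeff x I * coeff y (K - I)) * coeff z (S - K)) = T I (K - I) (S - K)"
        by (simp add: T_def mult.assoc qp_power_left_commute[of "coeff x I"] qp_power_swap add_ac)
    qed
    also have "\<dots> = (\<Sum>(K, I)\<in>Sigma (Pow S) Pow. T I (K - I) (S - K))"
      using \<open>finite S\<close> by (subst sum.Sigma) (auto intro: finite_subset)
    also have "\<dots> = (\<Sum>(I, J)\<in>(SIGMA I:Pow S. Pow (S - I)). T I J (S - I - J))"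
      by (rule sum.reindex_bij_witness[of _ "\<lambda>(I, J). (I \<union> J, I)" "\<lambda>(K, I). (I, K - I)"])
        (auto intro!: arg_cong2[of _ _ _ _ "T _"] simp: Diff_Diff_Int Int_absorb1)
    also have "\<dots> = (\<Sum>I\<in>Pow S. \<Sum>J\<in>Pow (S - I). T I J (S - I - J))"
      using \<open>finite S\<close> by (subst sum.Sigma) auto
    also have "\<dots> = (\<Sum>I\<in>Pow S. \<Sum>J\<in>Pow (S - I). qp ^ crossings I (S - I) * (coeff x I *
        (qp ^ crossings J (S - I - J) * (coeff y J * coeff z (S - I - J)))))"
    proof (intro sum.cong refl)
      fix I J assume "I \<in> Pow S" "J \<in> Pow (S - I)"
      then have "S - I = J \<union> (S - I - J)" by auto
      moreover have "crossings I (J \<union> (S - I - J)) = crossings I J + crossings I (S - I - J)"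
        using \<open>finite S\<close> \<open>I \<in> Pow S\<close> \<open>J \<in> Pow (S - I)\<close>
        by (intro crossings_Un_right) (auto intro: finite_subset)
      ultimately have "crossings I (S - I) = crossings I J + crossings I (S - I - J)"
        by metis
      then show "T I J (S - I - J) = qp ^ crossings I (S - I) * (coeff x I *
        (qp ^ crossings J (S - I - J) * (coeff y J * coeff z (S - I - J))))"
        by (simp add: T_def mult.assoc qp_power_left_commute[of "coeff x I"] qp_power_swap add_ac)
    qed
    also have "\<dots> = coeff (x * (y * z)) S"
      by (simp add: times_ext.rep_eq sum_distrib_left)
    finally show "coeff (x * y * z) S = coeff (x * (y * z)) S" .
  qed
  show "(x + y) * z = x * z + y * z" "x * (y + z) = x * y + x * z"
    by (rule ext_eqI, simp add: plus_ext.rep_eq times_ext.rep_eq distrib_left distrib_right sum.distrib)+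
  show "1 * x = x"
  proof (rule ext_eqI)
    fix S :: "nat set" assume "finite S"
    then have "coeff (1 * x) S = (\<Sum>I\<in>Pow S. if I = {} then coeff x S else 0)"
      unfolding coeff_simps by (intro sum.cong) auto
    then show "coeff (1 * x) S = coeff x S"
      using \<open>finite S\<close> by simp
  qed
  show "x * 1 = x"
  proof (rule ext_eqI)
    fix S :: "nat set" assume "finite S"
    then have "coeff (x * 1) S = (\<Sum>I\<in>Pow S. if I = S then coeff x S else 0)"
      unfolding coeff_simps by (intro sum.cong) auto
    then show "coeff (x * 1) S = coeff x S"
      using \<open>finite S\<close> by simp
  qed
  show "x + y + z = x + (y + z)" "x + y = y + x" "0 + x = x" "- x + x = 0" "x - y = x + - y"
    by (rule ext_eqI, simp add: zero_ext.rep_eq plus_ext.rep_eq minus_ext.rep_eq uminus_ext.rep_eq add_ac)+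
qed

end

section \<open>Constants and generators\<close>

lemma coeff_sum: "coeff (\<Sum>i\<in>A. f i) S = (\<Sum>i\<in>A. coeff (f i) S)"
  by (induction A rule: infinite_finite_induct) (auto simp: coeff_simps)

lift_definition const :: "'a::zero \<Rightarrow> 'a ext" is "\<lambda>a S. if S = {} then a else 0" by auto

lift_definition gen :: "nat \<Rightarrow> 'a::{zero,one} ext" is "\<lambda>j S. if S = {j} then 1 else 0" by auto

lemma coeff_const_mult: "coeff (const a * x) S = a * coeff (x :: 'a::q_ring ext) S"
proof (cases "finite S")
  case True
  then have "coeff (const a * x) S = (\<Sum>I\<in>Pow S. if I = {} then a * coeff x S else 0)"
    unfolding coeff_simps const.rep_eq by (intro sum.cong) auto
  then show ?thesis using True by simp
next
  case False
  then show ?thesis by (simp add: coeff_infinite)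
qed

lemma coeff_mult_const: "coeff (x * const a) S = coeff (x :: 'a::q_ring ext) S * a"
proof (cases "finite S")
  case True
  then have "coeff (x * const a) S = (\<Sum>I\<in>Pow S. if I = S then coeff x S * a else 0)"
    unfolding coeff_simps const.rep_eq by (intro sum.cong) auto
  then show ?thesis using True by simp
next
  case False
  then show ?thesis by (simp add: coeff_infinite)
qed

lemma coeff_gen_mult:
  assumes "finite S"
  shows "coeff (gen j * x) S =
    (if j \<in> S then qp ^ card {k \<in> S. k < j} * coeff (x :: 'a::q_ring ext) (S - {j}) else 0)"
proof -
  have "coeff (gen j * x) S =
      (\<Sum>I\<in>Pow S. if I = {j} then qp ^ crossings {j} (S - {j}) * coeff x (S - {j}) else 0)"
    unfolding coeff_simps gen.rep_eq by (intro sum.cong) auto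
  also have "\<dots> = (if j \<in> S then qp ^ crossings {j} (S - {j}) * coeff x (S - {j}) else 0)"
    using assms by simp
  moreover have "{k \<in> S - {j}. k < j} = {k \<in> S. k < j}" by auto
  ultimately show ?thesis by (simp add: crossings_singleton_left)
qed

lemma coeff_mult_gen:
  assumes "finite S"
  shows "coeff (x * gen j) S =
    (if j \<in> S then qp ^ card {k \<in> S. j < k} * coeff (x :: 'a::q_ring ext) (S - {j}) else 0)"
proof -
  have "coeff (x * gen j) S =
      (\<Sum>I\<in>Pow S. if I = S - {j} then if j \<in> S then qp ^ crossings (S - {j}) {j} * coeff x (S - {j}) else 0 else 0)"
    unfolding coeff_simps gen.rep_eq by (intro sum.cong) (auto simp: double_diff)
  also have "\<dots> = (if j \<in> S then qp ^ crossings (S - {j}) {j} * coeff x (S - {j}) else 0)"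
    using assms by simp
  moreover have "{k \<in> S - {j}. j < k} = {k \<in> S. j < k}" by auto
  ultimately show ?thesis by (simp add: crossings_singleton_right)
qed

lemma const_mult: "const (a * b) = const a * const (b :: 'a::q_ring)"
  by (rule ext_eqI) (auto simp: coeff_const_mult const.rep_eq)

lemma const_add: "const (a + b) = const a + const (b :: 'a::q_ring)"
  by (rule ext_eqI) (auto simp: coeff_simps const.rep_eq)

lemma const_0 [simp]: "const 0 = (0 :: 'a::q_ring ext)"
  by (rule ext_eqI) (auto simp: coeff_simps const.rep_eq)

lemma const_1 [simp]: "const 1 = (1 :: 'a::q_ring ext)"
  by (rule ext_eqI) (auto simp: coeff_simps const.rep_eq)

lemma const_qp_commute: "x * const qp = const qp * (x :: 'a::q_ring ext)"
  by (rule ext_eqI) (auto simp: coeff_const_mult coeff_mult_const qp_commute)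

lemma const_qp_left_commute: "x * (const qp * y) = const qp * (x * (y :: 'a::q_ring ext))"
  by (simp only: mult.assoc[symmetric] const_qp_commute[of x])

lemma gen_const_commute: "gen j * const a = const a * (gen j :: 'a::q_ring ext)"
  by (rule ext_eqI) (auto simp: coeff_const_mult coeff_mult_const gen.rep_eq)

lemma gen_const_left_commute: "gen j * (const a * x) = const a * (gen j * (x :: 'a::q_ring ext))"
  by (simp only: mult.assoc[symmetric] gen_const_commute)

lemma gen_square: "gen j * gen j = (0 :: 'a::q_ring ext)"
  by (rule ext_eqI) (auto simp: coeff_gen_mult gen.rep_eq zero_ext.rep_eq)

lemma gen_swap:
  assumes "i < j"
  shows "gen j * gen i = const qp * (gen i * (gen j :: 'a::q_ring ext))"
proof (rule ext_eqI)
  fix S :: "nat set" assume "finite S"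
  show "coeff (gen j * gen i) S = coeff (const qp * (gen i * gen j :: 'a ext)) S"
  proof (cases "S = {i, j}")
    case True
    have "card {k \<in> S. k < j} = 1" "card {k \<in> S. k < i} = 0" "S - {i} = {j}" "S - {j} = {i}"
    proof -
      have "{k \<in> S. k < j} = {i}" "{k \<in> S. k < i} = {}"
        using assms unfolding True by auto
      then show "card {k \<in> S. k < j} = 1" "card {k \<in> S. k < i} = 0"
        by simp_all
    qed (use assms in \<open>auto simp: True\<close>)
    moreover have "i \<in> S" "j \<in> S" using True by auto
    ultimately show ?thesis
      using \<open>finite S\<close> by (simp add: coeff_gen_mult coeff_const_mult gen.rep_eq del: card_0_eq)
  next
    case False
    then have "\<not> (i \<in> S \<and> S - {i} = {j})" "\<not> (j \<in> S \<and> S - {j} = {i})"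
      by blast+
    then show ?thesis
      using \<open>finite S\<close> by (auto simp: coeff_gen_mult coeff_const_mult gen.rep_eq)
  qed
qed

text \<open>\<open>restr R\<close> is the algebra homomorphism that sends \<open>gen j\<close> to 0 for \<open>j \<notin> R\<close>.\<close>

lift_definition restr :: "nat set \<Rightarrow> 'a::zero ext \<Rightarrow> 'a ext" is "\<lambda>R f S. if S \<subseteq> R then f S else 0"
  by auto

text \<open>All parts of a subset of \<open>R\<close> lie in \<open>R\<close>, and a set that leaves
  \<open>R\<close> cannot be split into two parts inside \<open>R\<close>.\<close>

lemma restr_mult: "restr R (x * y) = restr R x * restr R (y :: 'a::q_ring ext)"
proof (rule ext_eqI)
  fix S :: "nat set"
  show "coeff (restr R (x * y)) S = coeff (restr R x * restr R y) S"
  proof (cases "S \<subseteq> R")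
    case True
    then have "I \<subseteq> R" "S - I \<subseteq> R" if "I \<in> Pow S" for I
      using that by auto
    with True show ?thesis
      unfolding restr.rep_eq times_ext.rep_eq by simp
  next
    case False
    then have "\<not> (I \<subseteq> R \<and> S - I \<subseteq> R)" for I by blast
    then have "(if I \<subseteq> R then coeff x I else 0) * (if S - I \<subseteq> R then coeff y (S - I) else 0) = 0" for I
      by auto
    with False show ?thesis
      unfolding restr.rep_eq times_ext.rep_eq by simp
  qed
qed

lemma restr_add: "restr R (x + y) = restr R x + restr R (y :: 'a::q_ring ext)"
  by (rule ext_eqI) (auto simp: restr.rep_eq coeff_simps)

lemma restr_0 [simp]: "restr R 0 = (0 :: 'a::q_ring ext)"
  by (rule ext_eqI) (auto simp: restr.rep_eq coeff_simps)

lemma restr_1 [simp]: "restr R 1 = (1 :: 'a::q_ring ext)"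
  by (rule ext_eqI) (auto simp: restr.rep_eq coeff_simps)

lemma restr_sum: "restr R (\<Sum>i\<in>A. f i) = (\<Sum>i\<in>A. restr R (f i :: 'a::q_ring ext))"
  by (induction A rule: infinite_finite_induct) (auto simp: restr_add)

lemma restr_prod_list: "restr R (prod_list xs) = prod_list (map (restr R) (xs :: 'a::q_ring ext list))"
  by (induction xs) (auto simp: restr_mult)

lemma restr_const [simp]: "restr R (const a) = const (a :: 'a::q_ring)"
  by (rule ext_eqI) (auto simp: restr.rep_eq const.rep_eq)

lemma restr_gen: "restr R (gen j) = (if j \<in> R then gen j else 0 :: 'a::q_ring ext)"
  by (rule ext_eqI) (auto simp: restr.rep_eq gen.rep_eq coeff_simps)

section \<open>Linear forms with quantum matrix coefficients\<close>

definition row :: "nat set \<Rightarrow> (nat \<Rightarrow> 'a) \<Rightarrow> 'a::q_ring ext" where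
  "row R f = (\<Sum>j\<in>R. const (f j) * gen j)"

lemma restr_row: "finite R \<Longrightarrow> restr T (row R f) = row (R \<inter> T) f"
  by (simp add: row_def restr_sum restr_mult restr_gen if_distrib[of "(*) _"] sum.inter_restrict
      cong: if_cong)

lemma row_insert: "finite R \<Longrightarrow> j \<notin> R \<Longrightarrow> row (insert j R) f = const (f j) * gen j + row R f"
  by (simp add: row_def)

text \<open>Squares of generators vanish, and the terms for (j, k) and (k, j) merge at the price of
  one \<open>qp\<close>. The coefficient is the 2 by 2 quantum minor of the rows \<open>f\<close>
  and \<open>g\<close>, so relations between linear forms reduce to relations between such
  minors.\<close>

lemma row_mult:
  assumes "finite R"
  shows "row R f * row R g = (\<Sum>(j, k)\<in>{(j, k). j \<in> R \<and> k \<in> R \<and> j < k}.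
    const (f j * g k + qp * (f k * g j)) * (gen j * gen k))"
proof -
  define F where "F j k = const (f j * g k) * (gen j * gen k :: 'a ext)" for j k
  let ?L = "{(j, k). j \<in> R \<and> k \<in> R \<and> j < k}" and ?U = "{(k, j). j \<in> R \<and> k \<in> R \<and> j < k}"
    and ?D = "{(j, k). j \<in> R \<and> k = j}"
  have fin: "finite ?L" "finite ?U" "finite ?D"
    using assms by (auto intro: finite_subset[of _ "R \<times> R"])
  have "row R f * row R g = (\<Sum>j\<in>R. \<Sum>k\<in>R. F j k)"
    unfolding row_def sum_product F_def
    by (simp add: mult.assoc const_mult gen_const_left_commute)
  also have "\<dots> = (\<Sum>(j, k)\<in>R \<times> R. F j k)"
    by (simp add: sum.cartesian_product)
  also have "R \<times> R = ?L \<union> ?U \<union> ?D"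
    by auto
  also have "(\<Sum>(j, k)\<in>\<dots>. F j k) = (\<Sum>(j, k)\<in>?L. F j k) + (\<Sum>(j, k)\<in>?U. F j k) + (\<Sum>(j, k)\<in>?D. F j k)"
    by (subst sum.union_disjoint; (intro finite_UnI fin)?; (auto; fail)?)
      (subst sum.union_disjoint; (intro fin)?; auto)
  also have "(\<Sum>(j, k)\<in>?D. F j k) = 0"
    by (rule sum.neutral) (auto simp: F_def gen_square)
  also have "(\<Sum>(j, k)\<in>?U. F j k) = (\<Sum>(j, k)\<in>?L. F k j)"
    by (rule sum.reindex_bij_witness[of _ "\<lambda>(j, k). (k, j)" "\<lambda>(j, k). (k, j)"]) auto
  also have "(\<Sum>(j, k)\<in>?L. F j k) + \<dots> + 0 = (\<Sum>(j, k)\<in>?L. F j k + F k j)"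
    by (simp add: sum.distrib case_prod_unfold)
  also have "\<dots> = (\<Sum>(j, k)\<in>?L. const (f j * g k + qp * (f k * g j)) * (gen j * gen k))"
  proof (intro sum.cong refl, clarify)
    fix j k :: nat assume "j < k"
    then have "F k j = const (f k * g j) * (const qp * (gen j * gen k))"
      by (simp add: F_def gen_swap)
    also have "\<dots> = const (qp * (f k * g j)) * (gen j * gen k)"
      by (simp only: const_qp_left_commute const_mult mult.assoc)
    finally show "F j k + F k j = const (f j * g k + qp * (f k * g j)) * (gen j * gen k)"
      by (simp add: F_def const_add distrib_right)
  qed
  finally show ?thesis .
qed

text \<open>Since \<open>qp\<close> is -q, the first relation is the usual one with q, and
  \<open>qp_inv - qp\<close> is q - 1/q.\<close>

definition qmatrix :: "(nat \<Rightarrow> nat \<Rightarrow> 'a::q_ring) \<Rightarrow> bool" where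
  "qmatrix a \<longleftrightarrow>
    (\<forall>i k l. k < l \<longrightarrow> a i k * a i l + qp * (a i l * a i k) = 0) \<and>
    (\<forall>i j k l. i < j \<longrightarrow> k < l \<longrightarrow> a j k * a i l = a i l * a j k) \<and>
    (\<forall>i j k l. i < j \<longrightarrow> k < l \<longrightarrow>
      a i k * a j l - a j l * a i k = (qp_inv - qp) * (a i l * a j k))"

text \<open>For two equal rows, every minor in \<open>row_mult\<close> is the left side of the
  relation within a row.\<close>

lemma row_square:
  assumes "qmatrix a" "finite R"
  shows "row R (a i) * row R (a i) = 0"
  unfolding row_mult[OF assms(2)]
  by (rule sum.neutral) (use assms(1) in \<open>auto simp: qmatrix_def\<close>)

text \<open>Exchanging the rows of a 2 by 2 quantum minor multiplies it by -q. Thus the linear forms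
  obey the same exchange rule as the generators.\<close>

lemma row_swap:
  assumes "qmatrix a" "finite R" "i < j"
  shows "row R (a j) * row R (a i) = const qp * (row R (a i) * row R (a j))"
proof -
  have "a j k * a i l + qp * (a j l * a i k) = qp * (a i k * a j l + qp * (a i l * a j k))"
    if "k < l" for k l
  proof -
    have "a j k * a i l = a i l * a j k"
      using assms that by (auto simp: qmatrix_def)
    moreover have "a i k * a j l - a j l * a i k = (qp_inv - qp) * (a i l * a j k)"
      using assms that by (auto simp: qmatrix_def)
    then have "a j l * a i k = a i k * a j l - (qp_inv - qp) * (a i l * a j k)"
      by (simp add: algebra_simps)
    moreover have "qp * (qp_inv * (a i l * a j k)) = a i l * a j k"
      by (simp add: mult.assoc[symmetric] qp_inverse)
    ultimately show ?thesis
      by (simp add: left_diff_distrib right_diff_distrib distrib_left)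
  qed
  then show ?thesis
    unfolding row_mult[OF assms(2)] sum_distrib_left
    by (intro sum.cong) (auto simp: const_mult[symmetric] mult.assoc[symmetric])
qed

text \<open>
  The variables \<open>x\<close>, \<open>v i\<close> and \<open>t i\<close> stand for a generator of the \<open>q\<close>-exterior algebra, for
  linear forms in the later generators, and for the coefficients of \<open>x\<close> in the linear forms
  \<open>t i * x + v i\<close>; the scalar \<open>c\<close> is $-q$.
\<close>

locale linear_forms =
  fixes c x :: "'r :: {ring, monoid_mult}" and t v :: "nat \<Rightarrow> 'r"
  assumes c_commute: "y * c = c * y"
    and x_square: "x * x = 0"
    and t_x: "t i * x = x * t i"
    and v_x: "v i * x = c * (x * v i)"
    and v_square: "v i * v i = 0"
    and v_swap: "i < j \<Longrightarrow> v j * v i = c * (v i * v j)"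
    and t_v: "i < j \<Longrightarrow> t j * v i = v i * t j"
begin

lemma c_power_commute: "y * c ^ n = c ^ n * y"
proof (induction n)
  case (Suc n)
  have "y * c ^ Suc n = c * (y * c ^ n)"
    by (simp add: mult.assoc[symmetric] c_commute[of y])
  then show ?case
    by (simp add: Suc mult.assoc)
qed simp

lemma c_power_left_commute: "y * (c ^ n * z) = c ^ n * (y * z)"
  by (simp only: mult.assoc[symmetric] c_power_commute[of y])

lemma c_left_commute: "y * (c * z) = c * (y * z)"
  by (simp only: mult.assoc[symmetric] c_commute[of y])

definition tail :: "nat list \<Rightarrow> 'r" where
  "tail I = prod_list (map v I)"

text \<open>The cofactor of \<open>x\<close> in the product of the forms
  \<open>t i * x + v i\<close>: one form contributes its \<open>x\<close>, which is moved to the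
  front and picks up a \<open>c\<close> from every \<open>v h\<close> that it passes and none from
  the coefficients \<open>t h\<close>.\<close>

primrec lead :: "nat list \<Rightarrow> 'r" where
  "lead [] = 0"
| "lead (h # I) = t h * tail I + c * (v h * lead I)"

lemma tail_simps [simp]: "tail [] = 1" "tail (h # I) = v h * tail I"
  by (simp_all add: tail_def)

lemma tail_x: "tail I * x = c ^ length I * (x * tail I)"
proof (induction I)
  case (Cons h I)
  have "tail (h # I) * x = c ^ length I * (v h * x * tail I)"
    by (simp add: mult.assoc Cons c_power_left_commute[of "v h"])
  also have "\<dots> = c ^ length (h # I) * (x * tail (h # I))"
    by (simp add: v_x mult.assoc c_power_commute[of c, symmetric] c_power_left_commute[symmetric])
  finally show ?case .
qed simp

text \<open>The truncated exponent for \<open>I = []\<close> is harmless, since \<open>lead []\<close> vanishes.\<close>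

lemma lead_x: "lead I * x = c ^ (length I - 1) * (x * lead I)"
proof (induction I)
  case (Cons h I)
  have "t h * tail I * x = c ^ length I * (x * (t h * tail I))"
    by (simp add: mult.assoc tail_x c_power_left_commute[of "t h"])
      (simp add: mult.assoc[symmetric] t_x)
  moreover have "c * (v h * lead I) * x = c ^ length I * (x * (c * (v h * lead I)))"
  proof (cases I)
    case (Cons g J)
    have "c * (v h * lead I) * x = c * (c ^ length J * (v h * x * lead I))"
      by (simp only: mult.assoc Cons.IH c_power_left_commute[of "v h"])
        (simp add: Cons)
    also have "\<dots> = c ^ length I * (x * (c * (v h * lead I)))"
      by (simp add: v_x Cons mult.assoc c_left_commute[of x])
    finally show ?thesis .
  qed simp
  ultimately show ?case
    by (simp add: distrib_left distrib_right)
qed simp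

lemma prod_list_forms: "prod_list (map (\<lambda>i. t i * x + v i) I) = x * lead I + tail I"
proof (induction I)
  case (Cons h I)
  have "t h * x * (x * lead I) = 0"
    by (metis x_square mult.assoc mult_zero_left mult_zero_right)
  moreover have "t h * x * tail I = x * (t h * tail I)"
    by (simp add: t_x mult.assoc)
  moreover have "v h * (x * lead I) = x * (c * (v h * lead I))"
    by (simp add: v_x mult.assoc[symmetric] c_commute[of x])
  ultimately show ?case
    unfolding list.map prod_list.Cons Cons.IH by (simp add: distrib_left distrib_right add_ac)
qed simp

lemma tail_v:
  assumes "\<forall>h\<in>set I. i < h"
  shows "tail I * v i = c ^ length I * (v i * tail I)"
  using assms
proof (induction I)
  case (Cons h I)
  have "tail (h # I) * v i = c ^ length I * (v h * v i * tail I)"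
    using Cons by (simp add: mult.assoc c_power_left_commute[of "v h"])
  also have "\<dots> = c ^ length (h # I) * (v i * tail (h # I))"
    using Cons.prems
    by (simp add: v_swap mult.assoc c_power_commute[of c, symmetric] c_power_left_commute[symmetric])
  finally show ?case .
qed simp

text \<open>Each term of \<open>lead I\<close> has one coefficient, which commutes with
  \<open>v i\<close> by \<open>t_v\<close>, and \<open>length I - 1\<close> linear forms, each of
  which costs one \<open>c\<close>.\<close>

lemma lead_v:
  assumes "\<forall>h\<in>set I. i < h"
  shows "lead I * v i = c ^ (length I - 1) * (v i * lead I)"
  using assms
proof (induction I)
  case (Cons h I)
  have "t h * tail I * v i = c ^ length I * (t h * v i * tail I)"
    using Cons.prems by (simp add: mult.assoc tail_v c_power_left_commute[of "t h"])
  then have "t h * tail I * v i = c ^ length I * (v i * (t h * tail I))"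
    using Cons.prems by (simp add: t_v mult.assoc)
  moreover have "c * (v h * lead I) * v i = c ^ length I * (v i * (c * (v h * lead I)))"
  proof (cases I)
    case (Cons g J)
    have "c * (v h * lead I) * v i = c * (c ^ length J * (v h * v i * lead I))"
      using Cons.IH Cons.prems
      by (simp add: mult.assoc c_power_left_commute[of "v h"] Cons)
    also have "\<dots> = c ^ length I * (v i * (c * (v h * lead I)))"
      using Cons.prems by (simp add: v_swap Cons mult.assoc c_left_commute[of "v i"])
    finally show ?thesis .
  qed simp
  ultimately show ?case
    by (simp add: distrib_left distrib_right)
qed simp

text \<open>One \<open>c\<close> arises for every pair of a linear form in a term of
  \<open>lead I\<close> and a linear form in \<open>tail J\<close>. For two blocks of size m this
  gives the exponent m(m-1).\<close>

lemma lead_tail_commute: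
  assumes "\<forall>h\<in>set I. \<forall>i\<in>set J. i < h"
  shows "lead I * tail J = c ^ ((length I - 1) * length J) * (tail J * lead I)"
  using assms
proof (induction J)
  case (Cons i J)
  have "lead I * tail (i # J) = c ^ (length I - 1) * (v i * (lead I * tail J))"
    using lead_v[of I i] Cons.prems by (simp add: mult.assoc[symmetric])
  also have "\<dots> = c ^ (length I - 1) * (c ^ ((length I - 1) * length J) * (v i * (tail J * lead I)))"
    using Cons by (simp add: c_power_left_commute[of "v i"])
  finally show ?case
    by (simp add: power_add mult.assoc)
qed simp

text \<open>Moving the first form of the second copy to the left through the rest of the first copy
  produces \<open>v h * v h\<close>.\<close>

lemma tail_square:
  assumes "sorted_wrt (<) I" "I \<noteq> []"
  shows "tail I * tail I = 0"
proof -
  obtain h J where I: "I = h # J" using assms(2) by (cases I) auto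
  have "tail I * tail I = v h * (tail J * v h) * tail J"
    by (simp add: I mult.assoc)
  also have "\<dots> = c ^ length J * (v h * v h * (tail J * tail J))"
    using assms(1) by (simp add: I tail_v c_power_left_commute[of "v h"] mult.assoc)
  finally show ?thesis by (simp add: v_square)
qed

text \<open>Each term of \<open>lead I\<close> omits just one form, so from length 2 on it still
  shares a form with \<open>tail I\<close>, and the two copies can be brought together. For one form
  the product would be \<open>t h * v h\<close>, which nothing forces to vanish.\<close>

lemma lead_tail_zero:
  assumes "sorted_wrt (<) I" "2 \<le> length I"
  shows "lead I * tail I = 0"
proof -
  obtain h J where I: "I = h # J" using assms(2) by (cases I) auto
  with assms(2) have "J \<noteq> []" by auto
  have J: "sorted_wrt (<) J" "\<forall>g\<in>set J. h < g" using assms(1) I by auto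
  have "t h * tail J * (v h * tail J) = t h * (tail J * v h) * tail J"
    by (simp add: mult.assoc)
  also have "\<dots> = t h * (c ^ length J * (v h * (tail J * tail J)))"
    using J by (simp add: tail_v mult.assoc)
  also have "\<dots> = 0"
    using J \<open>J \<noteq> []\<close> by (simp add: tail_square)
  finally have 1: "t h * tail J * (v h * tail J) = 0" .
  have "v h * lead J * (v h * tail J) = v h * (lead J * v h) * tail J"
    by (simp add: mult.assoc)
  also have "\<dots> = c ^ (length J - 1) * (v h * v h * (lead J * tail J))"
    using J by (simp add: lead_v mult.assoc c_power_left_commute[of "v h"])
  also have "\<dots> = 0"
    by (simp add: v_square)
  finally have "v h * lead J * (v h * tail J) = 0" .
  with 1 show ?thesis
    by (simp add: I distrib_right mult.assoc)
qed

end

section \<open>Elementary symmetric functions\<close>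

primrec esym :: "'r :: {ring, monoid_mult} list \<Rightarrow> nat \<Rightarrow> 'r" where
  "esym [] p = (if p = 0 then 1 else 0)"
| "esym (z # zs) p = (case p of 0 \<Rightarrow> 1 | Suc p' \<Rightarrow> z * esym zs p' + esym zs p)"

lemma esym_0 [simp]: "esym zs 0 = 1"
  by (cases zs) auto

lemma esym_eq_0: "length zs < p \<Longrightarrow> esym zs p = 0"
  by (induction zs arbitrary: p) (auto split: nat.split)

lemma esym_length: "esym zs (length zs) = prod_list zs"
  by (induction zs) (auto simp: esym_eq_0)

lemma esym_Suc_0: "esym zs (Suc 0) = sum_list zs"
  by (induction zs) auto

text \<open>A product with two factors y vanishes, and a single y moves to the front past the b's of
  earlier positions. This yields only those terms of the right-hand product in which y and the b's
  have different positions; the others vanish as well, since there y_i can be moved to the right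
  until it meets b_i.\<close>

lemma esym_leading_part:
  fixes zs :: "('r \<times> 'r :: {ring, monoid_mult}) list"
  assumes "\<forall>(y, b)\<in>set zs. y * b = 0"
    and "\<forall>(y, b)\<in>set zs. \<forall>(y', b')\<in>set zs. y * y' = 0"
    and "sorted_wrt (\<lambda>(y, b) (y', b'). b * y' = y' * b) zs"
  shows "esym (map (\<lambda>(y, b). y + b) zs) (Suc p) =
    sum_list (map fst zs) * esym (map snd zs) p + esym (map snd zs) (Suc p)"
  using assms
proof (induction zs arbitrary: p)
  case (Cons z zs)
  obtain y b where z: "z = (y, b)" by (cases z)
  define Y where "Y = sum_list (map fst zs)"
  have "\<forall>z'\<in>set zs. y * fst z' = 0" "\<forall>z'\<in>set zs. b * fst z' = fst z' * b"
    using Cons.prems(2,3) z by auto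
  then have "y * Y = 0" "b * Y = Y * b"
    unfolding Y_def by (induction zs) (auto simp: distrib_left distrib_right)
  moreover have "y * b = 0"
    using Cons.prems(1) z by auto
  moreover have IH: "esym (map (\<lambda>(y, b). y + b) zs) (Suc p) =
      Y * esym (map snd zs) p + esym (map snd zs) (Suc p)" for p
    unfolding Y_def by (rule Cons.IH) (use Cons.prems in auto)
  ultimately show ?case
  proof (cases p)
    case (Suc p')
    have "y * (Y * w) = 0" "y * (b * w) = 0" "b * (Y * w) = Y * (b * w)" for w
      using \<open>y * Y = 0\<close> \<open>b * Y = Y * b\<close> \<open>y * b = 0\<close> by (simp_all add: mult.assoc[symmetric])
    then show ?thesis
      using IH[of p'] IH[of p] by (simp add: z Suc Y_def[symmetric] distrib_left distrib_right add_ac)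
  qed (use IH[of 0] in \<open>simp add: z Y_def[symmetric] distrib_left distrib_right add_ac\<close>)
qed simp

section \<open>Quantum minors as coefficients\<close>

text \<open>This is the Laplace expansion along the first row.\<close>

lemma coeff_row_mult:
  assumes "finite R" "S \<subseteq> R"
  shows "coeff (row R f * x) S = (\<Sum>j\<in>S. qp ^ card {k \<in> S. k < j} * (f j * coeff x (S - {j})))"
proof -
  have "finite S" using assms finite_subset by blast
  then have "coeff (row R f * x) S =
      (\<Sum>j\<in>R. if j \<in> S then qp ^ card {k \<in> S. k < j} * (f j * coeff x (S - {j})) else 0)"
    unfolding row_def sum_distrib_right coeff_sum
    by (intro sum.cong)
      (simp_all add: mult.assoc coeff_const_mult coeff_gen_mult qp_power_left_commute[of "f _"])
  also have "\<dots> = (\<Sum>j\<in>R \<inter> S. qp ^ card {k \<in> S. k < j} * (f j * coeff x (S - {j})))"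
    using assms(1) by (simp add: sum.inter_restrict)
  finally show ?thesis
    using assms(2) by (simp add: Int_absorb1)
qed

primrec list_inversions :: "nat list \<Rightarrow> nat" where
  "list_inversions [] = 0"
| "list_inversions (j # w) = length (filter (\<lambda>k. k < j) w) + list_inversions w"

lemma list_inversions_conv_card:
  "list_inversions w = card {(r, t). r < t \<and> t < length w \<and> w ! t < w ! r}"
proof (induction w)
  case (Cons j w)
  let ?A = "{t. t < length w \<and> w ! t < j}"
    and ?B = "{(r, t). r < t \<and> t < length w \<and> w ! t < w ! r}"
  have "{(r, t). r < t \<and> t < length (j # w) \<and> (j # w) ! t < (j # w) ! r} =
      (\<lambda>t. (0, Suc t)) ` ?A \<union> map_prod Suc Suc ` ?B"
    (is "?L = ?R")
  proof (intro equalityI subsetI)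
    fix z assume "z \<in> ?L"
    then obtain r t where z: "z = (r, t)" "r < t" "t < Suc (length w)" "(j # w) ! t < (j # w) ! r"
      by auto
    then obtain t' where "t = Suc t'" by (cases t) auto
    with z show "z \<in> ?R" by (cases r) (auto simp: image_iff)
  qed auto
  moreover have "finite ?B"
    by (rule finite_subset[of _ "{..<length w} \<times> {..<length w}"]) auto
  moreover have "inj_on (\<lambda>t. (0::nat, Suc t)) ?A" "inj_on (map_prod Suc Suc) ?B"
    by (auto simp: inj_on_def)
  ultimately have "card {(r, t). r < t \<and> t < length (j # w) \<and> (j # w) ! t < (j # w) ! r} =
      card ?A + card ?B"
    by (simp only:) (subst card_Un_disjoint, auto simp: card_image)
  then show ?case
    using Cons by (simp add: length_filter_conv_card)
qed simp

text \<open>Iterated Laplace expansion: the word \<open>w\<close> records the column chosen in each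
  row. If the first row takes column \<open>j\<close>, its factor counts the smaller columns that
  are left, which are the inversions starting at the first letter of \<open>w\<close>.\<close>

lemma coeff_prod_rows:
  assumes "finite R" "S \<subseteq> R"
  shows "coeff (prod_list (map (\<lambda>i. row R (a i)) I)) S =
    (if card S = length I
     then \<Sum>w\<in>permutations_of_set S. qp ^ list_inversions w * prod_list (map2 a I w) else 0)"
  using assms(2)
proof (induction I arbitrary: S)
  case Nil
  then have "finite S" using assms(1) finite_subset by blast
  then show ?case by (auto simp: one_ext.rep_eq)
next
  case (Cons i I)
  then have "finite S" using assms(1) finite_subset by blast
  define T where "T j w = qp ^ card {k \<in> S. k < j} * (a i j * (qp ^ list_inversions w * prod_list (map2 a I w)))" for j w
  have sub: "S - {j} \<subseteq> R" for j using Cons.prems by auto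
  have "coeff (prod_list (map (\<lambda>i. row R (a i)) (i # I))) S =
      (\<Sum>j\<in>S. if card S = Suc (length I) then \<Sum>w\<in>permutations_of_set (S - {j}). T j w else 0)"
  proof -
    have "card (S - {j}) = length I \<longleftrightarrow> card S = Suc (length I)" if "j \<in> S" for j
      using card_Suc_Diff1[OF \<open>finite S\<close> that] by auto
    then show ?thesis
      by (auto simp: coeff_row_mult[OF assms(1) Cons.prems] Cons.IH[OF sub] T_def sum_distrib_left
          simp del: card_Diff_insert intro!: sum.cong)
  qed
  also have "\<dots> = (if card S = Suc (length I) then \<Sum>j\<in>S. \<Sum>w\<in>permutations_of_set (S - {j}). T j w else 0)"
    by simp
  also have "\<dots> = (if card S = Suc (length I)
     then \<Sum>w\<in>permutations_of_set S. qp ^ list_inversions w * prod_list (map2 a (i # I) w) else 0)"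
  proof (intro if_cong refl)
    assume "card S = Suc (length I)"
    then have "S \<noteq> {}" by auto
    have "(\<Sum>w\<in>permutations_of_set S. qp ^ list_inversions w * prod_list (map2 a (i # I) w)) =
        (\<Sum>j\<in>S. \<Sum>w\<in>(#) j ` permutations_of_set (S - {j}).
          qp ^ list_inversions w * prod_list (map2 a (i # I) w))"
      unfolding permutations_of_set_nonempty[OF \<open>S \<noteq> {}\<close>]
      using \<open>finite S\<close> by (intro sum.UNION_disjoint) auto
    also have "\<dots> = (\<Sum>j\<in>S. \<Sum>w\<in>permutations_of_set (S - {j}). T j w)"
    proof (rule sum.cong[OF refl])
      fix j assume "j \<in> S"
      have "qp ^ list_inversions (j # w) * prod_list (map2 a (i # I) (j # w)) = T j w"
        if "w \<in> permutations_of_set (S - {j})" for w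
      proof -
        have w: "distinct w" "set w = S - {j}" using that by (auto dest: permutations_of_setD)
        then have "{k. k < j} \<inter> set w = {k \<in> S. k < j}" by auto
        with w(1) have "length (filter (\<lambda>k. k < j) w) = card {k \<in> S. k < j}"
          by (simp add: distinct_length_filter)
        then show ?thesis
          by (simp add: T_def power_add mult.assoc qp_power_left_commute[of "a i j"])
      qed
      then show "(\<Sum>w\<in>(#) j ` permutations_of_set (S - {j}).
          qp ^ list_inversions w * prod_list (map2 a (i # I) w)) =
          (\<Sum>w\<in>permutations_of_set (S - {j}). T j w)"
        by (subst sum.reindex) auto
    qed
    finally show "(\<Sum>j\<in>S. \<Sum>w\<in>permutations_of_set (S - {j}). T j w) =
        (\<Sum>w\<in>permutations_of_set S. qp ^ list_inversions w * prod_list (map2 a (i # I) w))" ..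
  qed
  finally show ?case by simp
qed

lemma bij_betw_permutes_permutations_of_set:
  assumes "distinct J"
  shows "bij_betw (\<lambda>\<sigma>. map (\<lambda>r. J ! \<sigma> r) [0..<length J])
    {\<sigma>. \<sigma> permutes {..<length J}} (permutations_of_set (set J))"
proof -
  let ?f = "\<lambda>\<sigma>. map (\<lambda>r. J ! \<sigma> r) [0..<length J]" and ?P = "{\<sigma>. \<sigma> permutes {..<length J}}"
  have less: "\<sigma> r < length J" if "\<sigma> \<in> ?P" "r < length J" for \<sigma> r
    using that permutes_in_image[of \<sigma> "{..<length J}" r] by auto
  have inj: "inj_on ?f ?P"
  proof (rule inj_onI)
    fix \<sigma> \<tau> assume *: "\<sigma> \<in> ?P" "\<tau> \<in> ?P" "?f \<sigma> = ?f \<tau>"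
    show "\<sigma> = \<tau>"
    proof
      fix r
      show "\<sigma> r = \<tau> r"
      proof (cases "r < length J")
        case True
        with *(3) have "J ! \<sigma> r = J ! \<tau> r"
          by simp
        then show ?thesis
          using nth_eq_iff_index_eq[OF assms less[OF *(1) True] less[OF *(2) True]] by simp
      next
        case False
        then show ?thesis
          using *(1,2) by (simp add: permutes_not_in)
      qed
    qed
  qed
  have "?f ` ?P \<subseteq> permutations_of_set (set J)"
  proof
    fix w assume "w \<in> ?f ` ?P"
    then obtain \<sigma> where s: "\<sigma> \<in> ?P" and w: "w = ?f \<sigma>" by auto
    have "set w = (\<lambda>i. J ! i) ` \<sigma> ` {..<length J}"
      by (auto simp: w image_image atLeast0LessThan[symmetric])
    also have "\<dots> = set J"
      using s permutes_image[of \<sigma> "{..<length J}"] by (auto simp: set_conv_nth image_iff)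
    finally have "set w = set J" .
    moreover from this have "distinct w"
      using assms by (intro card_distinct) (simp add: distinct_card w)
    ultimately show "w \<in> permutations_of_set (set J)" by (intro permutations_of_setI)
  qed
  \<comment> \<open>Surjectivity by counting: both sets have (length J)! elements.\<close>
  moreover have "card (?f ` ?P) = card (permutations_of_set (set J))"
    using assms inj by (simp add: card_image card_permutations[of "{..<length J}"] distinct_card)
  ultimately have "?f ` ?P = permutations_of_set (set J)"
    by (intro card_subset_eq) auto
  with inj show ?thesis by (simp add: bij_betw_def)
qed

text \<open>Since \<open>J\<close> is increasing, a word over \<open>set J\<close> has the same
  inversions as the permutation of positions that it describes.\<close>

lemma coeff_prod_rows_eq_minor:
  assumes "finite R" "set J \<subseteq> R" "sorted_wrt (<) J" "length J = length I"
  shows "coeff (prod_list (map (\<lambda>i. row R (a i)) I)) (set J) =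
    (\<Sum>\<sigma>\<in>{\<sigma>. \<sigma> permutes {..<length I}}. qp ^ inversions (length I) \<sigma> *
      prod_list (map (\<lambda>r. a (I ! r) (J ! \<sigma> r)) [0..<length I]))"
proof -
  have "distinct J" using assms(3) strict_sorted_iff by auto
  have "coeff (prod_list (map (\<lambda>i. row R (a i)) I)) (set J) =
      (\<Sum>w\<in>permutations_of_set (set J). qp ^ list_inversions w * prod_list (map2 a I w))"
    using assms \<open>distinct J\<close> by (simp add: coeff_prod_rows distinct_card)
  also have "\<dots> = (\<Sum>\<sigma>\<in>{\<sigma>. \<sigma> permutes {..<length I}}.
      qp ^ list_inversions (map (\<lambda>r. J ! \<sigma> r) [0..<length J]) *
      prod_list (map2 a I (map (\<lambda>r. J ! \<sigma> r) [0..<length J])))"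
    using sum.reindex_bij_betw[OF bij_betw_permutes_permutations_of_set[OF \<open>distinct J\<close>],
      of "\<lambda>w. qp ^ list_inversions w * prod_list (map2 a I w)"] assms(4)
    by simp
  also have "\<dots> = (\<Sum>\<sigma>\<in>{\<sigma>. \<sigma> permutes {..<length I}}. qp ^ inversions (length I) \<sigma> *
      prod_list (map (\<lambda>r. a (I ! r) (J ! \<sigma> r)) [0..<length I]))"
  proof (intro sum.cong refl)
    fix \<sigma> assume "\<sigma> \<in> {\<sigma>. \<sigma> permutes {..<length I}}"
    then have less: "\<sigma> r < length J" if "r < length J" for r
      using that permutes_in_image[of \<sigma> "{..<length J}" r] assms(4) by auto
    have "J ! i < J ! j \<longleftrightarrow> i < j" if "i < length J" "j < length J" for i j
      using that sorted_wrt_nth_less[OF assms(3), of i j] sorted_wrt_nth_less[OF assms(3), of j i]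
      by (cases i j rule: linorder_cases) auto
    then have "{(r, t). r < t \<and> t < length J \<and> J ! \<sigma> t < J ! \<sigma> r} =
        {(r, t). r < t \<and> t < length J \<and> \<sigma> t < \<sigma> r}"
      using less by auto
    moreover have "list_inversions (map (\<lambda>r. J ! \<sigma> r) [0..<length J]) =
        card {(r, t). r < t \<and> t < length J \<and> J ! \<sigma> t < J ! \<sigma> r}"
      unfolding list_inversions_conv_card by (intro arg_cong[of _ _ card]) auto
    ultimately have "list_inversions (map (\<lambda>r. J ! \<sigma> r) [0..<length J]) = inversions (length I) \<sigma>"
      using assms(4) by (simp add: inversions_def)
    moreover have "map2 a I (map (\<lambda>r. J ! \<sigma> r) [0..<length J]) =
        map (\<lambda>r. a (I ! r) (J ! \<sigma> r)) [0..<length I]"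
      using assms(4) by (intro nth_equalityI) auto
    ultimately show "qp ^ list_inversions (map (\<lambda>r. J ! \<sigma> r) [0..<length J]) *
      prod_list (map2 a I (map (\<lambda>r. J ! \<sigma> r) [0..<length J])) = qp ^ inversions (length I) \<sigma> *
      prod_list (map (\<lambda>r. a (I ! r) (J ! \<sigma> r)) [0..<length I])"
      by simp
  qed
  finally show ?thesis .
qed

section \<open>Expansion along the smallest generator\<close>

lemma restr_esym: "restr R (esym zs p) = esym (map (restr R) zs) (p :: nat)" for zs :: "'a::q_ring ext list"
  by (induction zs arbitrary: p) (auto simp: restr_add restr_mult split: nat.split)

lemma const_mult_row: "const b * row R f = row R (\<lambda>k. b * f k)"
  by (simp add: row_def sum_distrib_left const_mult mult.assoc)

lemma row_mult_const: "row R f * const b = row R (\<lambda>k. f k * b)"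
  by (simp add: row_def sum_distrib_right const_mult mult.assoc gen_const_commute)

lemma row_mult_gen:
  assumes "\<forall>k\<in>R. s < k"
  shows "row R f * gen s = const qp * (gen s * row R f)"
proof -
  have "const (f k) * gen k * gen s = const qp * (gen s * (const (f k) * gen k))" if "k \<in> R" for k
    using that assms
    by (simp add: gen_swap mult.assoc const_qp_left_commute[of "const _"] gen_const_left_commute)
  then show ?thesis
    by (simp add: row_def sum_distrib_left sum_distrib_right)
qed

text \<open>The rows keep only the columns after \<open>s\<close>: then \<open>gen s\<close>
  precedes all remaining generators, and \<open>t_v\<close> is an instance of the relation a_jk a_il
  = a_il a_jk with k = s.\<close>

lemma linear_forms_rows:
  assumes "qmatrix a"
  shows "linear_forms (const qp) (gen s) (\<lambda>i. const (a i s)) (\<lambda>i. row {s<..M} (a i))"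
proof
  show "const (a j s) * row {s<..M} (a i) = row {s<..M} (a i) * const (a j s)" if "i < j" for i j
    unfolding const_mult_row row_mult_const unfolding row_def
    using assms that by (intro sum.cong refl) (auto simp: qmatrix_def)
qed (use assms in \<open>auto simp: const_qp_commute gen_square gen_const_commute row_mult_gen row_square row_swap\<close>)

lemma const_power: "const a ^ n = const (a ^ n :: 'a :: q_ring)"
  by (induction n) (auto simp: const_mult)

lemma coeff_sum_list: "coeff (sum_list zs) S = sum_list (map (\<lambda>z. coeff z S) (zs :: 'a::q_ring ext list))"
  by (induction zs) (auto simp: coeff_simps)

lemma restr_sum_list: "restr R (sum_list zs) = sum_list (map (restr R) (zs :: 'a::q_ring ext list))"
  by (induction zs) (auto simp: restr_add)

text \<open>The root of unity condition is imposed on multiples of the entries and not on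
  \<open>qp\<close> itself: the lemma is applied in the product of all algebras, where
  \<open>qp\<close> has components for every nonzero q.\<close>

lemma coeff_esym_expand:
  fixes a :: "nat \<Rightarrow> nat \<Rightarrow> 'a :: q_ring"
  assumes a: "qmatrix a" "\<And>i j. qp ^ (m * (m - 1)) * a i j = qp ^ m * a i j"
    and m: "2 \<le> m"
    and Bs: "\<And>I. I \<in> set Bs \<Longrightarrow> sorted_wrt (<) I \<and> length I = m"
      "sorted_wrt (\<lambda>I J. \<forall>i\<in>set I. \<forall>j\<in>set J. i < j) Bs"
    and S: "S \<subseteq> {1..M}" "s \<in> S" "\<And>k. k \<in> S \<Longrightarrow> s \<le> k"
  defines "\<Omega> \<equiv> map (\<lambda>I. prod_list (map (\<lambda>i. row {1..M} (a i)) I)) Bs"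
  shows "coeff (esym \<Omega> (Suc p)) S =
    (\<Sum>I\<in>{I. I \<subseteq> S \<and> s \<in> I \<and> card I = m}. qp ^ crossings I (S - I) *
      (coeff (sum_list \<Omega>) I * coeff (esym \<Omega> p) (S - I)))"
proof -
  interpret linear_forms "const qp" "gen s" "\<lambda>i. const (a i s)" "\<lambda>i. row {s<..M} (a i)"
    using a(1) by (rule linear_forms_rows)
  let ?R = "{s..M}" and ?R' = "{s<..M}"
  \<comment> \<open>The pairs (y, beta), one for each block.\<close>
  define zs where "zs = map (\<lambda>I. (gen s * lead I, tail I)) Bs"
  have s: "1 \<le> s" "s \<le> M" and fin: "finite S"
    using S by (auto intro: finite_subset)
  have SR: "S \<subseteq> ?R" using S by auto
  have SR': "I \<subseteq> ?R' \<longleftrightarrow> s \<notin> I" if "I \<subseteq> S" for I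
  proof
    assume "s \<notin> I"
    show "I \<subseteq> ?R'"
    proof
      fix k assume "k \<in> I"
      with that S have "s \<le> k" "k \<le> M" by auto
      moreover have "s \<noteq> k" using \<open>k \<in> I\<close> \<open>s \<notin> I\<close> by auto
      ultimately show "k \<in> ?R'" by auto
    qed
  qed auto
  have "restr ?R (row {1..M} f) = const (f s) * gen s + row ?R' f"
    and "restr ?R' (row {1..M} f) = row ?R' f" for f :: "nat \<Rightarrow> 'a"
  proof -
    have "{1..M} \<inter> ?R = insert s ?R'" "{1..M} \<inter> ?R' = ?R'" using s by auto
    then show "restr ?R (row {1..M} f) = const (f s) * gen s + row ?R' f"
      "restr ?R' (row {1..M} f) = row ?R' f"
      by (simp_all add: restr_row row_insert)
  qed
  then have restr: "map (restr ?R) \<Omega> = map (\<lambda>(y, b). y + b) zs" "map (restr ?R') \<Omega> = map snd zs"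
    by (auto simp: \<Omega>_def zs_def restr_prod_list o_def prod_list_forms tail_def)

  have "\<forall>(y, b)\<in>set zs. y * b = 0"
    using Bs m by (auto simp: zs_def mult.assoc lead_tail_zero)
  moreover have "gen s * lead I * (gen s * lead J) = 0" for I J
  proof -
    have "gen s * lead I * (gen s * lead J) = gen s * (lead I * gen s) * lead J"
      by (simp add: mult.assoc)
    also have "\<dots> = const qp ^ (length I - 1) * (gen s * gen s * lead I * lead J)"
      by (simp add: lead_x c_power_left_commute[of "gen s"] mult.assoc)
    finally show ?thesis by (simp add: gen_square)
  qed
  then have "\<forall>(y, b)\<in>set zs. \<forall>(y', b')\<in>set zs. y * y' = 0"
    by (auto simp: zs_def)
  moreover have "sorted_wrt (\<lambda>(y, b) (y', b'). b * y' = y' * b) zs"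
    unfolding zs_def sorted_wrt_map
  proof (rule sorted_wrt_mono_rel[OF _ Bs(2)], clarify)
    fix I J assume "I \<in> set Bs" "J \<in> set Bs" and less: "\<forall>i\<in>set I. \<forall>j\<in>set J. i < j"
    then have len: "length I = m" "length J = m" using Bs by auto
    \<comment> \<open>The power hypothesis acts only on a factor that contains a matrix entry; the
      first row of the nonempty block \<open>I\<close> provides one.\<close>
    then obtain h I' where "I = h # I'" using m by (cases I) auto
    then have "const qp ^ (m * (m - 1)) * tail I = const qp ^ m * tail I"
      using a(2) by (simp add: mult.assoc[symmetric] const_power const_mult_row)
    then have tail: "const qp ^ (m * (m - 1)) * (tail I * w) = const qp ^ m * (tail I * w)" for w
      by (simp add: mult.assoc[symmetric])
    \<comment> \<open>The exponent m(m-1) comes from \<open>lead J\<close> passing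
      \<open>tail I\<close>; after its replacement by m it is exactly what \<open>gen s\<close>
      needs to pass \<open>tail I\<close> in the other direction.\<close>
    have "gen s * lead J * tail I = gen s * (const qp ^ (m * (m - 1)) * (tail I * lead J))"
      using less len lead_tail_commute[of J I] by (simp add: mult.assoc mult.commute[of m])
    also have "\<dots> = const qp ^ m * (gen s * tail I) * lead J"
      by (subst tail) (simp add: mult.assoc c_power_left_commute[of "gen s"])
    also have "\<dots> = tail I * gen s * lead J"
      by (simp add: tail_x len)
    also have "\<dots> = tail I * (gen s * lead J)"
      by (rule mult.assoc)
    finally show "tail I * (gen s * lead J) = gen s * lead J * tail I" ..
  qed
  ultimately have "restr ?R (esym \<Omega> (Suc p)) =
      sum_list (map fst zs) * restr ?R' (esym \<Omega> p) + restr ?R' (esym \<Omega> (Suc p))"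
    unfolding restr_esym restr by (rule esym_leading_part)
  moreover have "coeff (restr ?R (esym \<Omega> (Suc p))) S = coeff (esym \<Omega> (Suc p)) S"
    using SR by (simp add: restr.rep_eq)
  \<comment> \<open>The summand that is free of the smallest generator has no term at
    \<open>S\<close>, which contains \<open>s\<close>.\<close>
  moreover have "coeff (restr ?R' (esym \<Omega> (Suc p))) S = 0"
    using SR'[of S] S by (simp add: restr.rep_eq)
  ultimately have "coeff (esym \<Omega> (Suc p)) S =
      coeff (sum_list (map fst zs) * restr ?R' (esym \<Omega> p)) S"
    by (simp add: plus_ext.rep_eq)
  also have "\<dots> = (\<Sum>I\<in>Pow S. qp ^ crossings I (S - I) *
      (coeff (sum_list (map fst zs)) I * coeff (restr ?R' (esym \<Omega> p)) (S - I)))"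
    by (simp add: times_ext.rep_eq)
  also have "\<dots> = (\<Sum>I\<in>Pow S. if s \<in> I \<and> card I = m then qp ^ crossings I (S - I) *
      (coeff (sum_list \<Omega>) I * coeff (esym \<Omega> p) (S - I)) else 0)"
  proof (intro sum.cong refl)
    fix I assume "I \<in> Pow S"
    then have I: "I \<subseteq> S" "I \<subseteq> ?R" "I \<subseteq> {1..M}" using SR S by auto
    \<comment> \<open>For \<open>I\<close> inside \<open>S\<close>, both restrictions can be read
      off: the first leaves the coefficient at \<open>I\<close> unchanged, and the second kills it
      exactly if \<open>s\<close> lies in \<open>I\<close>. Their difference is the coefficient of
      the sum of the y's.\<close>
    have "restr ?R (sum_list \<Omega>) = sum_list (map fst zs) + restr ?R' (sum_list \<Omega>)"
      unfolding restr_sum_list restr by (simp add: case_prod_unfold sum_list_addf)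
    then have "coeff (restr ?R (sum_list \<Omega>)) I =
        coeff (sum_list (map fst zs)) I + coeff (restr ?R' (sum_list \<Omega>)) I"
      by (simp add: plus_ext.rep_eq)
    then have "coeff (sum_list (map fst zs)) I = (if s \<in> I then coeff (sum_list \<Omega>) I else 0)"
      using I SR'[OF I(1)] by (simp add: restr.rep_eq split: if_splits)
    \<comment> \<open>Every block consists of m linear forms, so the sum is homogeneous of degree
      m.\<close>
    moreover have "coeff (sum_list \<Omega>) I = 0" if "card I \<noteq> m"
      using Bs(1) that I(3) unfolding coeff_sum_list \<Omega>_def
      by (simp add: coeff_prod_rows o_def cong: map_cong)
    moreover have "coeff (restr ?R' (esym \<Omega> p)) (S - I) = coeff (esym \<Omega> p) (S - I)" if "s \<in> I"
      using SR'[of "S - I"] that by (auto simp: restr.rep_eq)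
    ultimately show "qp ^ crossings I (S - I) *
      (coeff (sum_list (map fst zs)) I * coeff (restr ?R' (esym \<Omega> p)) (S - I)) =
      (if s \<in> I \<and> card I = m then qp ^ crossings I (S - I) *
      (coeff (sum_list \<Omega>) I * coeff (esym \<Omega> p) (S - I)) else 0)"
      by auto
  qed
  also have "\<dots> = (\<Sum>I\<in>{I \<in> Pow S. s \<in> I \<and> card I = m}. qp ^ crossings I (S - I) *
      (coeff (sum_list \<Omega>) I * coeff (esym \<Omega> p) (S - I)))"
    using fin by (intro sum.inter_filter[symmetric]) simp
  finally show ?thesis
    by (simp add: Pow_def)
qed

section \<open>The product of all complex algebras\<close>

locale complex_algebra = ring A for A :: "(complex, 'a) module" (structure) +
  assumes smult_closed [simp, intro]: "x \<in> carrier A \<Longrightarrow> c \<odot> x \<in> carrier A"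
    and smult_l_distr: "x \<in> carrier A \<Longrightarrow> (c + d) \<odot> x = c \<odot> x \<oplus> d \<odot> x"
    and smult_assoc: "x \<in> carrier A \<Longrightarrow> (c * d) \<odot> x = c \<odot> (d \<odot> x)"
    and smult_one: "x \<in> carrier A \<Longrightarrow> 1 \<odot> x = x"
    and smult_m_left: "x \<in> carrier A \<Longrightarrow> y \<in> carrier A \<Longrightarrow> (c \<odot> x) \<otimes> y = c \<odot> (x \<otimes> y)"
    and smult_m_right: "x \<in> carrier A \<Longrightarrow> y \<in> carrier A \<Longrightarrow> x \<otimes> (c \<odot> y) = c \<odot> (x \<otimes> y)"
begin

lemma smult_zero [simp]: "c \<odot> \<zero> = \<zero>"
  using smult_m_left[of "\<zero>" "\<zero>" c] by (simp add: smult_closed)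

lemma smult_zero_left [simp]: "x \<in> carrier A \<Longrightarrow> 0 \<odot> x = \<zero>"
  using smult_l_distr[of x 0 0] add.l_cancel_one'[of "0 \<odot> x" "0 \<odot> x"] by simp

lemma smult_minus: "x \<in> carrier A \<Longrightarrow> \<ominus> (c \<odot> x) = (- c) \<odot> x"
  using smult_l_distr[of x "- c" c] by (intro minus_equality) auto

lemma smult_eq: "x \<in> carrier A \<Longrightarrow> c \<odot> x = (c \<odot> \<one>) \<otimes> x"
  by (simp add: smult_m_left)

end

text \<open>
  The product of all algebras on a given carrier type, with one copy of each algebra for every
  possible value of \<open>q\<close>, is a type of class \<open>q_ring\<close>. Equations can thus be proved in the type
  class and then be read off in a single component.
\<close>

definition alg_index :: "((complex, 'a) module \<times> complex) set" where
  "alg_index = {(A, q). complex_algebra A \<and> q \<noteq> 0}"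

typedef 'a alg_prod = "PiE (alg_index :: ((complex, 'a) module \<times> complex) set) (\<lambda>(A, q). carrier A)"
  morphisms component Abs_alg_prod
proof -
  have "\<zero>\<^bsub>A\<^esub> \<in> carrier A" if "(A, q) \<in> alg_index" for A :: "(complex, 'a) module" and q
  proof -
    interpret complex_algebra A using that by (simp add: alg_index_def)
    show ?thesis by simp
  qed
  then have "restrict (\<lambda>(A, q). \<zero>\<^bsub>A\<^esub>) alg_index \<in> PiE (alg_index :: ((complex, 'a) module \<times> complex) set) (\<lambda>(A, q). carrier A)"
    by auto
  then show ?thesis by blast
qed

setup_lifting type_definition_alg_prod

lemma alg_prod_eqI:
  assumes "\<And>A q. complex_algebra A \<Longrightarrow> q \<noteq> 0 \<Longrightarrow> component x (A, q) = component y (A, q)"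
  shows "x = y"
proof -
  have "component x i = component y i" if "i \<in> alg_index" for i
    using assms[of "fst i" "snd i"] that by (auto simp: alg_index_def)
  then have "component x = component y"
    using component[of x] component[of y] by (intro PiE_ext)
  then show ?thesis by (simp add: component_inject)
qed

lemma component_closed:
  "complex_algebra A \<Longrightarrow> q \<noteq> 0 \<Longrightarrow> component x (A, q) \<in> carrier A"
  using component[of x] by (auto simp: alg_index_def PiE_iff)

lemma algebra_closed:
  assumes "(A, q) \<in> alg_index" "x \<in> carrier A" "y \<in> carrier A"
  shows "x \<oplus>\<^bsub>A\<^esub> y \<in> carrier A" "x \<otimes>\<^bsub>A\<^esub> y \<in> carrier A" "x \<ominus>\<^bsub>A\<^esub> y \<in> carrier A" "\<ominus>\<^bsub>A\<^esub> x \<in> carrier A"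
    "c \<odot>\<^bsub>A\<^esub> x \<in> carrier A"
proof -
  interpret complex_algebra A using assms(1) by (simp add: alg_index_def)
  show "x \<oplus>\<^bsub>A\<^esub> y \<in> carrier A" "x \<otimes>\<^bsub>A\<^esub> y \<in> carrier A" "x \<ominus>\<^bsub>A\<^esub> y \<in> carrier A" "\<ominus>\<^bsub>A\<^esub> x \<in> carrier A"
    "c \<odot>\<^bsub>A\<^esub> x \<in> carrier A"
    using assms by auto
qed

lemma algebra_const_closed:
  assumes "(A, q) \<in> alg_index"
  shows "\<zero>\<^bsub>A\<^esub> \<in> carrier A" "\<one>\<^bsub>A\<^esub> \<in> carrier A"
proof -
  interpret complex_algebra A using assms(1) by (simp add: alg_index_def)
  show "\<zero>\<^bsub>A\<^esub> \<in> carrier A" "\<one>\<^bsub>A\<^esub> \<in> carrier A"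
    by auto
qed

instantiation alg_prod :: (type) q_ring
begin

lift_definition zero_alg_prod :: "'a alg_prod" is "restrict (\<lambda>(A, q). \<zero>\<^bsub>A\<^esub>) alg_index"
  by (auto simp: algebra_const_closed)
lift_definition one_alg_prod :: "'a alg_prod" is "restrict (\<lambda>(A, q). \<one>\<^bsub>A\<^esub>) alg_index"
  by (auto simp: algebra_const_closed)
lift_definition plus_alg_prod :: "'a alg_prod \<Rightarrow> 'a alg_prod \<Rightarrow> 'a alg_prod" is
  "\<lambda>x y. restrict (\<lambda>(A, q). x (A, q) \<oplus>\<^bsub>A\<^esub> y (A, q)) alg_index"
  by (auto simp: PiE_iff intro!: algebra_closed)
lift_definition minus_alg_prod :: "'a alg_prod \<Rightarrow> 'a alg_prod \<Rightarrow> 'a alg_prod" is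
  "\<lambda>x y. restrict (\<lambda>(A, q). x (A, q) \<ominus>\<^bsub>A\<^esub> y (A, q)) alg_index"
  by (auto simp: PiE_iff intro!: algebra_closed)
lift_definition uminus_alg_prod :: "'a alg_prod \<Rightarrow> 'a alg_prod" is
  "\<lambda>x. restrict (\<lambda>(A, q). \<ominus>\<^bsub>A\<^esub> x (A, q)) alg_index"
  by (auto simp: PiE_iff intro!: algebra_closed)
lift_definition times_alg_prod :: "'a alg_prod \<Rightarrow> 'a alg_prod \<Rightarrow> 'a alg_prod" is
  "\<lambda>x y. restrict (\<lambda>(A, q). x (A, q) \<otimes>\<^bsub>A\<^esub> y (A, q)) alg_index"
  by (auto simp: PiE_iff intro!: algebra_closed)
lift_definition qp_alg_prod :: "'a alg_prod" is
  "restrict (\<lambda>(A, q). (- q) \<odot>\<^bsub>A\<^esub> \<one>\<^bsub>A\<^esub>) alg_index"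
  by (auto intro!: algebra_closed algebra_const_closed)
lift_definition qp_inv_alg_prod :: "'a alg_prod" is
  "restrict (\<lambda>(A, q). inverse (- q) \<odot>\<^bsub>A\<^esub> \<one>\<^bsub>A\<^esub>) alg_index"
  by (auto intro!: algebra_closed algebra_const_closed)

lemmas component_rep_eqs = zero_alg_prod.rep_eq one_alg_prod.rep_eq plus_alg_prod.rep_eq minus_alg_prod.rep_eq
  uminus_alg_prod.rep_eq times_alg_prod.rep_eq qp_alg_prod.rep_eq qp_inv_alg_prod.rep_eq

lemma component_simps:
  assumes "complex_algebra A" "q \<noteq> 0"
  shows "component 0 (A, q) = \<zero>\<^bsub>A\<^esub>" "component 1 (A, q) = \<one>\<^bsub>A\<^esub>"
    "component (x + y) (A, q) = component x (A, q) \<oplus>\<^bsub>A\<^esub> component y (A, q)"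
    "component (x - y) (A, q) = component x (A, q) \<ominus>\<^bsub>A\<^esub> component y (A, q)"
    "component (- x) (A, q) = \<ominus>\<^bsub>A\<^esub> component x (A, q)"
    "component (x * y) (A, q) = component x (A, q) \<otimes>\<^bsub>A\<^esub> component y (A, q)"
    "component qp (A, q) = (- q) \<odot>\<^bsub>A\<^esub> \<one>\<^bsub>A\<^esub>"
    "component qp_inv (A, q) = inverse (- q) \<odot>\<^bsub>A\<^esub> \<one>\<^bsub>A\<^esub>"
  using assms by (simp_all add: component_rep_eqs alg_index_def)

instance
proof
  fix x y z :: "'a alg_prod"
  have eqs: "component (x + y + z) (A, q) = component (x + (y + z)) (A, q)"
    "component (x + y) (A, q) = component (y + x) (A, q)"
    "component (0 + x) (A, q) = component x (A, q)"
    "component (- x + x) (A, q) = component 0 (A, q)"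
    "component (x - y) (A, q) = component (x + - y) (A, q)"
    "component (x * y * z) (A, q) = component (x * (y * z)) (A, q)"
    "component ((x + y) * z) (A, q) = component (x * z + y * z) (A, q)"
    "component (x * (y + z)) (A, q) = component (x * y + x * z) (A, q)"
    "component (1 * x) (A, q) = component x (A, q)"
    "component (x * 1) (A, q) = component x (A, q)"
    "component (qp * x) (A, q) = component (x * qp) (A, q)"
    "component (qp * qp_inv) (A, q) = component 1 (A, q)"
    if A: "complex_algebra A" and q: "q \<noteq> 0" for A :: "(complex, 'a) module" and q
  proof -
    interpret complex_algebra A by fact
    note * = component_simps[OF A q] component_closed[OF A q]
    show "component (x + y + z) (A, q) = component (x + (y + z)) (A, q)"
      "component (x + y) (A, q) = component (y + x) (A, q)"
      "component (0 + x) (A, q) = component x (A, q)"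
      "component (- x + x) (A, q) = component 0 (A, q)"
      "component (x - y) (A, q) = component (x + - y) (A, q)"
      "component (x * y * z) (A, q) = component (x * (y * z)) (A, q)"
      "component ((x + y) * z) (A, q) = component (x * z + y * z) (A, q)"
      "component (x * (y + z)) (A, q) = component (x * y + x * z) (A, q)"
      "component (1 * x) (A, q) = component x (A, q)"
      "component (x * 1) (A, q) = component x (A, q)"
      by (simp_all add: * a_ac l_neg r_neg a_minus_def m_assoc l_distr r_distr)
    show "component (qp * x) (A, q) = component (x * qp) (A, q)"
      by (simp add: * smult_m_left smult_m_right)
    show "component (qp * qp_inv) (A, q) = component 1 (A, q)"
      using q by (simp add: * smult_m_left smult_m_right smult_assoc[symmetric] smult_one)
  qed
  show "x + y + z = x + (y + z)" "x + y = y + x" "0 + x = x" "- x + x = 0" "x - y = x + - y"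
    "x * y * z = x * (y * z)" "(x + y) * z = x * z + y * z" "x * (y + z) = x * y + x * z"
    "1 * x = x" "x * 1 = x" "qp * x = x * qp" "qp * qp_inv = (1 :: 'a alg_prod)"
    by (rule alg_prod_eqI, rule eqs; assumption)+
qed

end

text \<open>The membership test for \<open>x\<close> keeps the result in the product for every
  argument, as the lifting requires.\<close>

lift_definition single :: "(complex, 'a) module \<Rightarrow> complex \<Rightarrow> 'a \<Rightarrow> 'a alg_prod" is
  "\<lambda>A q x. restrict (\<lambda>(B, r). if B = A \<and> r = q \<and> x \<in> carrier A then x else \<zero>\<^bsub>B\<^esub>) alg_index"
  by (auto simp: algebra_const_closed)

lemma component_single:
  assumes "complex_algebra B" "r \<noteq> 0"
  shows "component (single A q x) (B, r) = (if B = A \<and> r = q \<and> x \<in> carrier A then x else \<zero>\<^bsub>B\<^esub>)"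
  using assms by (simp add: single.rep_eq alg_index_def)

context complex_algebra
begin

context
  fixes q :: complex
  assumes q: "q \<noteq> 0"
begin

lemmas comp = component_simps[OF complex_algebra_axioms q]
  and comp_closed [simp, intro] = component_closed[OF complex_algebra_axioms q]

lemma comp_sum: "component (\<Sum>i\<in>S. f i) (A, q) = (\<Oplus>i\<in>S. component (f i) (A, q))"
  by (induction S rule: infinite_finite_induct) (auto simp: comp)

lemma comp_prod_list:
  "component (prod_list xs) (A, q) = foldr (\<otimes>) (map (\<lambda>x. component x (A, q)) xs) \<one>"
  by (induction xs) (auto simp: comp)

lemma comp_qp_power_mult: "component (qp ^ n * x) (A, q) = (- q) ^ n \<odot> component x (A, q)"
proof (induction n)
  case (Suc n)
  have "component (qp ^ Suc n * x) (A, q) = component (qp * (qp ^ n * x)) (A, q)"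
    by (simp add: mult.assoc)
  also have "\<dots> = (- q) \<odot> component (qp ^ n * x) (A, q)"
    by (simp only: comp(6)[of qp] comp(7)) (simp add: smult_m_left)
  also have "\<dots> = (- q) ^ Suc n \<odot> component x (A, q)"
    by (simp only: Suc power_Suc smult_assoc comp_closed)
  finally show ?case .
qed (simp add: smult_one)

text \<open>The bridge from minors in a record to coefficients in the exterior algebra. The entries
  have to agree only on the rows and columns of the minor, which permits a comparison with the
  extended matrix.\<close>

lemma qminor_eq_component:
  assumes "finite R" "set J \<subseteq> R" "sorted_wrt (<) J" "length J = length I"
    and a: "\<And>i j. i \<in> set I \<Longrightarrow> j \<in> set J \<Longrightarrow> a i j = component (a' i j) (A, q)"
  shows "qminor A q a I J =
    component (coeff (prod_list (map (\<lambda>i. row R (a' i)) I)) (set J)) (A, q)"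
proof -
  have entries: "map (\<lambda>r. a (I ! r) (J ! \<sigma> r)) [0..<length I] =
      map (\<lambda>r. component (a' (I ! r) (J ! \<sigma> r)) (A, q)) [0..<length I]"
    if "\<sigma> permutes {..<length I}" for \<sigma>
    using permutes_in_image[OF that] assms(4) by (intro map_cong a) auto
  have "(- q) ^ inversions (length I) \<sigma> \<odot>
      foldr (\<otimes>) (map (\<lambda>r. a (I ! r) (J ! \<sigma> r)) [0..<length I]) \<one> =
      component (qp ^ inversions (length I) \<sigma> *
        prod_list (map (\<lambda>r. a' (I ! r) (J ! \<sigma> r)) [0..<length I])) (A, q)"
    if "\<sigma> permutes {..<length I}" for \<sigma>
    by (simp only: entries[OF that] comp_qp_power_mult comp_prod_list map_map o_def)
  with assms show ?thesis
    unfolding coeff_prod_rows_eq_minor[OF assms(1-4)] qminor_def comp_sum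
    by (intro add.finprod_cong') auto
qed

end

end

section \<open>The bracket as a coefficient\<close>

lemma crossings_image:
  assumes "strict_mono_on A f" "I \<subseteq> A" "J \<subseteq> A"
  shows "crossings (f ` I) (f ` J) = crossings I J"
proof -
  have less: "f j < f i \<longleftrightarrow> j < i" if "i \<in> A" "j \<in> A" for i j
    using that assms(1) by (metis strict_mono_on_less)
  have inj: "inj_on f A" using assms(1) by (rule strict_mono_on_imp_inj_on)
  have "{(i, j). i \<in> f ` I \<and> j \<in> f ` J \<and> j < i} = map_prod f f ` {(i, j). i \<in> I \<and> j \<in> J \<and> j < i}"
    using assms less by (auto simp: image_iff subset_iff)
  moreover have "inj_on (map_prod f f) {(i, j). i \<in> I \<and> j \<in> J \<and> j < i}"
    using inj assms by (auto simp: inj_on_def)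
  ultimately show ?thesis
    by (simp add: crossings_def card_image)
qed

text \<open>The summands are the ranks of the elements of \<open>P\<close>, hence 1 up to
  \<open>card P\<close>.\<close>

lemma sum_card_atMost:
  fixes P :: "nat set"
  assumes "finite P"
  shows "(\<Sum>i\<in>P. card {j \<in> P. j \<le> i}) = \<Sum>{1..card P}"
  using assms
proof (induction P rule: finite_linorder_max_induct)
  case (insert b P)
  have "b \<notin> P" using insert by auto
  have "{j \<in> insert b P. j \<le> b} = insert b P" using insert by (auto intro: less_imp_le)
  moreover have "{j \<in> insert b P. j \<le> i} = {j \<in> P. j \<le> i}" if "i \<in> P" for i
    using insert that by auto
  ultimately show ?case
    using insert \<open>b \<notin> P\<close> by (simp add: atLeastAtMostSuc_conv)
qed simp

text \<open>The i numbers up to an element i of \<open>P\<close> are those in \<open>P\<close>,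
  counted by the rank of i, and those outside, counted by its crossings. Summing over
  \<open>P\<close> shows that the bracket exponent, the sum of j_t - t, is a crossing
  number.\<close>

lemma crossings_complement:
  fixes P :: "nat set"
  assumes "P \<subseteq> {1..L}"
  shows "crossings P ({1..L} - P) + \<Sum>{1..card P} = \<Sum>P"
proof -
  have fin: "finite P" using assms finite_subset by blast
  have "{(i, j). i \<in> P \<and> j \<in> {1..L} - P \<and> j < i} = (SIGMA i:P. {j \<in> {1..L} - P. j < i})"
    by auto
  then have "crossings P ({1..L} - P) = (\<Sum>i\<in>P. card {j \<in> {1..L} - P. j < i})"
    using fin by (simp add: crossings_def)
  then have "crossings P ({1..L} - P) + \<Sum>{1..card P} =
      (\<Sum>i\<in>P. card {j \<in> {1..L} - P. j < i} + card {j \<in> P. j \<le> i})"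
    using sum_card_atMost[OF fin] by (simp add: sum.distrib)
  also have "\<dots> = (\<Sum>i\<in>P. i)"
  proof (intro sum.cong refl)
    fix i assume "i \<in> P"
    then have "i \<in> {1..L}" using assms by blast
    have "{j \<in> {1..L} - P. j < i} \<union> {j \<in> P. j \<le> i} = {1..i}"
    proof (intro equalityI subsetI)
      fix j assume "j \<in> {1..i}"
      moreover have "j \<noteq> i" if "j \<notin> P" using that \<open>i \<in> P\<close> by blast
      ultimately show "j \<in> {j \<in> {1..L} - P. j < i} \<union> {j \<in> P. j \<le> i}"
        using \<open>i \<in> {1..L}\<close> by (cases "j \<in> P") auto
    next
      fix j assume "j \<in> {j \<in> {1..L} - P. j < i} \<union> {j \<in> P. j \<le> i}"
      then show "j \<in> {1..i}" using assms by fastforce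
    qed
    then have "card ({j \<in> {1..L} - P. j < i} \<union> {j \<in> P. j \<le> i}) = i" by simp
    then show "card {j \<in> {1..L} - P. j < i} + card {j \<in> P. j \<le> i} = i"
      using fin by (subst (asm) card_Un_disjoint) auto
  qed
  finally show ?thesis .
qed

lemma set_nths_shift: "set (nths S {i. i + 1 \<in> P}) = (\<lambda>i. S ! (i - 1)) ` (P \<inter> {1..length S})"
proof (intro equalityI subsetI)
  fix x assume "x \<in> set (nths S {i. i + 1 \<in> P})"
  then obtain i where "x = S ! i" "i < length S" "i + 1 \<in> P"
    by (auto simp: set_nths)
  then show "x \<in> (\<lambda>i. S ! (i - 1)) ` (P \<inter> {1..length S})"
    by (intro image_eqI[of _ _ "i + 1"]) auto
next
  fix x assume "x \<in> (\<lambda>i. S ! (i - 1)) ` (P \<inter> {1..length S})"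
  then obtain i where "x = S ! (i - 1)" "i \<in> P" "1 \<le> i" "i \<le> length S"
    by auto
  then show "x \<in> set (nths S {i. i + 1 \<in> P})"
    unfolding set_nths by (intro CollectI exI[of _ "i - 1"]) auto
qed

lemma positions:
  assumes "sorted_wrt (<) S"
  shows "strict_mono_on {1..length S} (\<lambda>i. S ! (i - 1))"
    and "(\<lambda>i. S ! (i - 1)) ` {1..length S} = set S"
proof -
  show "strict_mono_on {1..length S} (\<lambda>i. S ! (i - 1))"
    using assms by (intro strict_mono_onI) (auto intro!: sorted_wrt_nth_less[OF assms])
  show "(\<lambda>i. S ! (i - 1)) ` {1..length S} = set S"
    using set_nths_shift[of S UNIV] by (simp add: nths_all)
qed

lemma sublist_at_positions:
  assumes S: "sorted_wrt (<) S" and P: "P \<subseteq> {1..length S}"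
  shows "set (nths S {i. i + 1 \<in> P}) = (\<lambda>i. S ! (i - 1)) ` P"
    "set (nths S {i. i + 1 \<notin> P}) = set S - (\<lambda>i. S ! (i - 1)) ` P"
    "sorted_wrt (<) (nths S {i. i + 1 \<in> P})" "sorted_wrt (<) (nths S {i. i + 1 \<notin> P})"
    "length (nths S {i. i + 1 \<in> P}) = card P"
    "length (nths S {i. i + 1 \<notin> P}) = length S - card P"
    "crossings ((\<lambda>i. S ! (i - 1)) ` P) (set S - (\<lambda>i. S ! (i - 1)) ` P) = \<Sum>P - \<Sum>{1..card P}"
proof -
  let ?g = "\<lambda>i. S ! (i - 1)"
  note g = positions[OF S]
  have inj: "inj_on ?g {1..length S}" using g(1) by (rule strict_mono_on_imp_inj_on)
  have image_diff: "?g ` ({1..length S} - P) = set S - ?g ` P"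
    using inj_on_image_set_diff[OF inj, of "{1..length S}" P] P g(2) by simp
  have fin: "finite P" using P finite_subset by blast
  show 1: "set (nths S {i. i + 1 \<in> P}) = ?g ` P"
    using set_nths_shift[of S P] P by (simp add: Int_absorb2)
  have "- P \<inter> {1..length S} = {1..length S} - P" by auto
  then show 2: "set (nths S {i. i + 1 \<notin> P}) = set S - ?g ` P"
    using set_nths_shift[of S "- P"] image_diff by simp
  have sorted: "sorted S" "distinct S" using S strict_sorted_iff by auto
  then show "sorted_wrt (<) (nths S {i. i + 1 \<in> P})" "sorted_wrt (<) (nths S {i. i + 1 \<notin> P})"
    by (auto simp: strict_sorted_iff sorted_nths distinct_nthsI)
  have card: "card (?g ` P) = card P"
    using inj_on_subset[OF inj P] by (rule card_image)
  show "length (nths S {i. i + 1 \<in> P}) = card P"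
    using distinct_card[OF distinct_nthsI[OF sorted(2), of "{i. i + 1 \<in> P}"]] card
    unfolding 1 by simp
  have "?g ` P \<subseteq> set S" using P g(2) by auto
  then have "card (set S - ?g ` P) = length S - card P"
    using card distinct_card[OF sorted(2)] fin by (simp add: card_Diff_subset)
  then show "length (nths S {i. i + 1 \<notin> P}) = length S - card P"
    using distinct_card[OF distinct_nthsI[OF sorted(2), of "{i. i + 1 \<notin> P}"]]
    unfolding 2 by simp
  \<comment> \<open>The increasing map from positions to entries preserves crossings, so the
    exponent may be computed on positions.\<close>
  have "crossings (?g ` P) (?g ` ({1..length S} - P)) = crossings P ({1..length S} - P)"
    using g(1) P by (rule crossings_image) auto
  then show "crossings (?g ` P) (set S - ?g ` P) = \<Sum>P - \<Sum>{1..card P}"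
    using crossings_complement[OF P] unfolding image_diff by simp
qed

text \<open>The bracket always takes the first entry and chooses the other m - 1 by position; in the
  exterior algebra this is the choice of an m-subset containing the minimum.\<close>

lemma bij_betw_positions:
  fixes S :: "nat list"
  assumes S: "sorted_wrt (<) S" "S \<noteq> []" and m: "1 \<le> m"
  shows "bij_betw (\<lambda>J. (\<lambda>i. S ! (i - 1)) ` insert 1 J) {J. J \<subseteq> {2..length S} \<and> card J = m - 1}
    {I. I \<subseteq> set S \<and> S ! 0 \<in> I \<and> card I = m}"
    (is "bij_betw ?f ?D ?E")
proof -
  let ?g = "\<lambda>i. S ! (i - 1)"
  note g = positions[OF S(1)]
  have inj: "inj_on ?g {1..length S}" using g(1) by (rule strict_mono_on_imp_inj_on)
  have ins: "insert 1 J \<subseteq> {1..length S}" if "J \<in> ?D" for J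
    using that S(2) by (auto simp: Suc_le_eq)
  have "?f J \<in> ?E" if J: "J \<in> ?D" for J
  proof -
    have "?f J \<subseteq> set S" using ins[OF J] unfolding g(2)[symmetric] by (rule image_mono)
    moreover have "card (?f J) = card (insert 1 J)"
      by (rule card_image) (rule inj_on_subset[OF inj ins[OF J]])
    moreover have "finite J" "1 \<notin> J" using J by (auto intro: finite_subset)
    ultimately show ?thesis using J m by simp
  qed
  moreover have "I \<in> ?f ` ?D" if I: "I \<in> ?E" for I
  proof -
    define P where "P = {i \<in> {1..length S}. ?g i \<in> I}"
    have "?g ` P = I"
    proof -
      have "?g ` P = ?g ` {1..length S} \<inter> I"
        unfolding P_def by blast
      then show ?thesis using I g(2) by auto
    qed
    have "1 \<in> P" using I S(2) by (auto simp: P_def Suc_le_eq)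
    have "card (?g ` P) = card P"
      by (rule card_image) (rule inj_on_subset[OF inj], auto simp: P_def)
    then have "card P = m" using I \<open>?g ` P = I\<close> by simp
    moreover have "P - {1} \<subseteq> {2..length S}" by (auto simp: P_def)
    moreover have "insert 1 (P - {1}) = P" using \<open>1 \<in> P\<close> by auto
    ultimately show ?thesis
      using \<open>?g ` P = I\<close> \<open>1 \<in> P\<close> by (intro image_eqI[of _ _ "P - {1}"]) auto
  qed
  moreover have "inj_on ?f ?D"
  proof (rule inj_onI)
    fix J K assume J: "J \<in> ?D" and K: "K \<in> ?D" and "?f J = ?f K"
    then have "insert 1 J = insert 1 K"
      using inj_on_image_eq_iff[OF inj ins[OF J] ins[OF K]] by blast
    moreover have "1 \<notin> J" "1 \<notin> K" using J K by auto
    ultimately show "J = K" by (simp add: insert_ident)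
  qed
  ultimately show ?thesis
    by (intro bij_betw_imageI equalityI image_subsetI subsetI)
qed

text \<open>With \<open>p\<close> recursion steps a bracket has p + 1 factors \<open>b\<close>,
  whence the degree \<open>Suc p\<close>. The list \<open>S\<close> is arbitrary in the induction
  because the recursion passes to sublists; the matrix and its blocks stay fixed.\<close>

lemma (in complex_algebra) hyper_bracket_eq_component:
  fixes a :: "nat \<Rightarrow> nat \<Rightarrow> 'a alg_prod"
  assumes q: "q \<noteq> 0"
    and a: "qmatrix a" "\<And>i j. qp ^ (m * (m - 1)) * a i j = qp ^ m * a i j"
    and m: "2 \<le> m"
    and Bs: "\<And>I. I \<in> set Bs \<Longrightarrow> sorted_wrt (<) I \<and> length I = m"
      "sorted_wrt (\<lambda>I J. \<forall>i\<in>set I. \<forall>j\<in>set J. i < j) Bs"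
    and \<Omega>: "\<Omega> = map (\<lambda>I. prod_list (map (\<lambda>i. row {1..M} (a i)) I)) Bs"
    and b: "\<And>J. sorted_wrt (<) J \<Longrightarrow> set J \<subseteq> {1..M} \<Longrightarrow> length J = m \<Longrightarrow>
      b J = component (coeff (sum_list \<Omega>) (set J)) (A, q)"
    and S: "sorted_wrt (<) S" "set S \<subseteq> {1..M}" "length S = m * (p + 1)"
  shows "hyper_bracket A q m b p S = component (coeff (esym \<Omega> (Suc p)) (set S)) (A, q)"
  using S
proof (induction p arbitrary: S)
  case 0
  then show ?case by (simp add: b esym_Suc_0)
next
  case (Suc p)
  let ?L = "length S" and ?g = "\<lambda>i. S ! (i - 1)"
  let ?D = "{J. J \<subseteq> {2..?L} \<and> card J = m - 1}"
  let ?F = "\<lambda>I. qp ^ crossings I (set S - I) *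
    (coeff (sum_list \<Omega>) I * coeff (esym \<Omega> (Suc p)) (set S - I))"
  have "S \<noteq> []" using Suc.prems(3) m by auto
  have summand: "(- q) ^ (\<Sum>J - \<Sum>{2..m}) \<odot>
      (b (nths S {i. i + 1 \<in> insert 1 J}) \<otimes> hyper_bracket A q m b p (nths S {i. i + 1 \<notin> insert 1 J})) =
      component (?F (?g ` insert 1 J)) (A, q)" if J: "J \<in> ?D" for J
  proof -
    have P: "insert 1 J \<subseteq> {1..?L}" using J \<open>S \<noteq> []\<close> by (auto simp: Suc_le_eq)
    have J': "finite J" "1 \<notin> J" using J by (auto intro: finite_subset)
    then have card: "card (insert 1 J) = m" using J m by simp
    note sub = sublist_at_positions[OF Suc.prems(1) P, unfolded card]
    have "b (nths S {i. i + 1 \<in> insert 1 J}) = component (coeff (sum_list \<Omega>) (?g ` insert 1 J)) (A, q)"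
      unfolding sub(1)[symmetric]
      by (intro b sub(3,5) order_trans[OF set_nths_subset Suc.prems(2)])
    moreover have "hyper_bracket A q m b p (nths S {i. i + 1 \<notin> insert 1 J}) =
        component (coeff (esym \<Omega> (Suc p)) (set S - ?g ` insert 1 J)) (A, q)"
      unfolding sub(2)[symmetric]
      by (intro Suc.IH sub(4) order_trans[OF set_nths_subset Suc.prems(2)])
        (simp only: sub(6) Suc.prems(3), simp)
    \<comment> \<open>The position 1 adds the same amount to both sums, so the bracket exponent,
      which runs over j_2, ..., j_m, equals the one with the first position included.\<close>
    moreover have "{1..m} = insert 1 {2..m}" using m by auto
    then have "\<Sum>(insert 1 J) - \<Sum>{1..m} = \<Sum>J - \<Sum>{2..m}"
      using J' by simp
    then have "crossings (?g ` insert 1 J) (set S - ?g ` insert 1 J) = \<Sum>J - \<Sum>{2..m}"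
      using sub(7) by simp
    ultimately show ?thesis
      by (simp only: comp_qp_power_mult[OF q]) (simp only: comp[OF q])
  qed
  have "hyper_bracket A q m b (Suc p) S = (\<Oplus>J\<in>?D. component (?F (?g ` insert 1 J)) (A, q))"
    unfolding hyper_bracket.simps using q summand by (intro add.finprod_cong') auto
  also have "\<dots> = component (\<Sum>J\<in>?D. ?F (?g ` insert 1 J)) (A, q)"
    by (simp only: comp_sum[OF q])
  also have "(\<Sum>J\<in>?D. ?F (?g ` insert 1 J)) =
      (\<Sum>I\<in>{I. I \<subseteq> set S \<and> S ! 0 \<in> I \<and> card I = m}. ?F I)"
    using Suc.prems(1) \<open>S \<noteq> []\<close> m
    by (intro sum.reindex_bij_betw[where g = ?F] bij_betw_positions) auto
  also have "\<dots> = coeff (esym \<Omega> (Suc (Suc p))) (set S)"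
  proof -
    have "S ! 0 \<le> k" if "k \<in> set S" for k
      using that Suc.prems(1) by (cases S) (auto intro: less_imp_le)
    then show ?thesis
      unfolding \<Omega> using \<open>S \<noteq> []\<close>
      by (intro coeff_esym_expand[OF a m Bs Suc.prems(2), symmetric]) auto
  qed
  finally show ?case .
qed

section \<open>Quantum matrices in complex algebras\<close>

text \<open>The relations of \<open>qmatrix\<close> for a record and for indices up to
  \<open>M\<close>, in a form that fits both the generators and their block diagonal
  extension.\<close>

definition quantum_matrix :: "(complex, 'a) module \<Rightarrow> complex \<Rightarrow> nat \<Rightarrow> (nat \<Rightarrow> nat \<Rightarrow> 'a) \<Rightarrow> bool" where
  "quantum_matrix A q M x \<longleftrightarrow>
    (\<forall>i\<in>{1..M}. \<forall>j\<in>{1..M}. x i j \<in> carrier A) \<and>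
    (\<forall>i\<in>{1..M}. \<forall>k\<in>{1..M}. \<forall>l\<in>{1..M}. k < l \<longrightarrow>
      x i k \<otimes>\<^bsub>A\<^esub> x i l = q \<odot>\<^bsub>A\<^esub> (x i l \<otimes>\<^bsub>A\<^esub> x i k)) \<and>
    (\<forall>i\<in>{1..M}. \<forall>j\<in>{1..M}. \<forall>k\<in>{1..M}. \<forall>l\<in>{1..M}. i < j \<longrightarrow> k < l \<longrightarrow>
      x j k \<otimes>\<^bsub>A\<^esub> x i l = x i l \<otimes>\<^bsub>A\<^esub> x j k \<and>
      x i k \<otimes>\<^bsub>A\<^esub> x j l \<ominus>\<^bsub>A\<^esub> x j l \<otimes>\<^bsub>A\<^esub> x i k = (q - inverse q) \<odot>\<^bsub>A\<^esub> (x i l \<otimes>\<^bsub>A\<^esub> x j k))"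

definition lift_matrix ::
    "(complex, 'a) module \<Rightarrow> complex \<Rightarrow> nat \<Rightarrow> (nat \<Rightarrow> nat \<Rightarrow> 'a) \<Rightarrow> nat \<Rightarrow> nat \<Rightarrow> 'a alg_prod" where
  "lift_matrix A q M x i j = (if i \<in> {1..M} \<and> j \<in> {1..M} then single A q (x i j) else 0)"

lemma component_lift_matrix:
  assumes "complex_algebra B" "r \<noteq> 0" "quantum_matrix A q M x"
  shows "component (lift_matrix A q M x i j) (B, r) =
    (if B = A \<and> r = q \<and> i \<in> {1..M} \<and> j \<in> {1..M} then x i j else \<zero>\<^bsub>B\<^esub>)"
  using assms by (auto simp: lift_matrix_def component_single component_simps quantum_matrix_def)

text \<open>At the component (A, q) with all indices in range this is the hypothesis. In all other
  cases every product in the relation has a zero factor, since each index of the relation occurs in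
  each of its products.\<close>

lemma qmatrix_lift_matrix:
  assumes x: "quantum_matrix A q M x"
  shows "qmatrix (lift_matrix A q M x)"
  unfolding qmatrix_def
proof (intro conjI allI impI; rule alg_prod_eqI)
  fix B :: "(complex, 'a) module" and r :: complex and i j k l :: nat
  assume B: "complex_algebra B" and r: "r \<noteq> 0"
  interpret B: complex_algebra B by fact
  note comp = component_simps[OF B r] component_closed[OF B r]
  let ?X = "lift_matrix A q M x"
  have rel: "quantum_matrix B r M x \<and> component (?X i' k') (B, r) = x i' k'"
    if "B = A \<and> r = q" "i' \<in> {1..M}" "k' \<in> {1..M}" for i' k'
    using that x component_lift_matrix[OF B r x, of i' k'] by auto
  have zero: "component (?X i' k') (B, r) = \<zero>\<^bsub>B\<^esub>"
    if "\<not> ((B = A \<and> r = q) \<and> i' \<in> {1..M} \<and> k' \<in> {1..M})" for i' k'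
    using that component_lift_matrix[OF B r x, of i' k'] by auto
  {
    assume "k < l"
    show "component (?X i k * ?X i l + qp * (?X i l * ?X i k)) (B, r) = component 0 (B, r)"
    proof (cases "(B = A \<and> r = q) \<and> i \<in> {1..M} \<and> k \<in> {1..M} \<and> l \<in> {1..M}")
      case True
      then have "x i k \<in> carrier B" "x i l \<in> carrier B"
        "x i k \<otimes>\<^bsub>B\<^esub> x i l = r \<odot>\<^bsub>B\<^esub> (x i l \<otimes>\<^bsub>B\<^esub> x i k)"
        using rel[of i k] \<open>k < l\<close> unfolding quantum_matrix_def by blast+
      moreover have "component (?X i k) (B, r) = x i k" "component (?X i l) (B, r) = x i l"
        using True rel by blast+
      ultimately show ?thesis
        using B.smult_l_distr[of "x i l \<otimes>\<^bsub>B\<^esub> x i k" r "- r"]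
        by (simp add: component_simps[OF B r] B.smult_m_left)
    next
      case False
      then have "component (?X i k) (B, r) = \<zero>\<^bsub>B\<^esub> \<or> component (?X i l) (B, r) = \<zero>\<^bsub>B\<^esub>"
        using zero by blast
      then show ?thesis by (auto simp: comp)
    qed
  }
  {
    assume "i < j" "k < l"
    show "component (?X j k * ?X i l) (B, r) = component (?X i l * ?X j k) (B, r)"
    proof (cases "(B = A \<and> r = q) \<and> i \<in> {1..M} \<and> j \<in> {1..M} \<and> k \<in> {1..M} \<and> l \<in> {1..M}")
      case True
      then have "x j k \<otimes>\<^bsub>B\<^esub> x i l = x i l \<otimes>\<^bsub>B\<^esub> x j k"
        using rel[of i k] \<open>i < j\<close> \<open>k < l\<close> unfolding quantum_matrix_def by blast
      moreover have "component (?X j k) (B, r) = x j k" "component (?X i l) (B, r) = x i l"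
        using True rel by blast+
      ultimately show ?thesis
        by (simp add: component_simps[OF B r])
    next
      case False
      then have "component (?X j k) (B, r) = \<zero>\<^bsub>B\<^esub> \<or> component (?X i l) (B, r) = \<zero>\<^bsub>B\<^esub>"
        using zero by blast
      then show ?thesis by (auto simp: comp)
    qed
    show "component (?X i k * ?X j l - ?X j l * ?X i k) (B, r) =
      component ((qp_inv - qp) * (?X i l * ?X j k)) (B, r)"
    proof (cases "(B = A \<and> r = q) \<and> i \<in> {1..M} \<and> j \<in> {1..M} \<and> k \<in> {1..M} \<and> l \<in> {1..M}")
      case True
      let ?y = "x i l \<otimes>\<^bsub>B\<^esub> x j k"
      have carr: "x i l \<in> carrier B" "x j k \<in> carrier B"
        and rel_B: "x i k \<otimes>\<^bsub>B\<^esub> x j l \<ominus>\<^bsub>B\<^esub> x j l \<otimes>\<^bsub>B\<^esub> x i k = (r - inverse r) \<odot>\<^bsub>B\<^esub> ?y"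
        using rel[of i k] \<open>i < j\<close> \<open>k < l\<close> True unfolding quantum_matrix_def by blast+
      have "inverse (- r) \<odot>\<^bsub>B\<^esub> \<one>\<^bsub>B\<^esub> \<ominus>\<^bsub>B\<^esub> (- r) \<odot>\<^bsub>B\<^esub> \<one>\<^bsub>B\<^esub> = (r - inverse r) \<odot>\<^bsub>B\<^esub> \<one>\<^bsub>B\<^esub>"
        using B.smult_l_distr[of "\<one>\<^bsub>B\<^esub>" "inverse (- r)" r] by (simp add: a_minus_def B.smult_minus)
      then have "(inverse (- r) \<odot>\<^bsub>B\<^esub> \<one>\<^bsub>B\<^esub> \<ominus>\<^bsub>B\<^esub> (- r) \<odot>\<^bsub>B\<^esub> \<one>\<^bsub>B\<^esub>) \<otimes>\<^bsub>B\<^esub> ?y = (r - inverse r) \<odot>\<^bsub>B\<^esub> ?y"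
        using carr B.smult_m_left[of "\<one>\<^bsub>B\<^esub>" ?y] by simp
      moreover have "component (?X i k) (B, r) = x i k" "component (?X i l) (B, r) = x i l"
        "component (?X j k) (B, r) = x j k" "component (?X j l) (B, r) = x j l"
        using True rel by blast+
      ultimately show ?thesis
        using rel_B by (simp only: component_simps[OF B r])
    next
      case False
      then have "component (?X i k) (B, r) = \<zero>\<^bsub>B\<^esub> \<or> component (?X j l) (B, r) = \<zero>\<^bsub>B\<^esub>"
        "component (?X i l) (B, r) = \<zero>\<^bsub>B\<^esub> \<or> component (?X j k) (B, r) = \<zero>\<^bsub>B\<^esub>"
        using zero by blast+
      then have "component (?X i k * ?X j l) (B, r) = \<zero>\<^bsub>B\<^esub>" "component (?X j l * ?X i k) (B, r) = \<zero>\<^bsub>B\<^esub>"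
        "component (?X i l * ?X j k) (B, r) = \<zero>\<^bsub>B\<^esub>"
        by (auto simp: comp)
      then show ?thesis
        unfolding component_simps(4)[OF B r] component_simps(6)[OF B r, of "qp_inv - qp"]
        by (simp add: a_minus_def component_closed[OF B r])
    qed
  }
qed

text \<open>In the other components the two powers of \<open>qp\<close> need not agree, but there
  the entry is zero.\<close>

lemma lift_matrix_power:
  assumes "quantum_matrix A q M x" "(- q) ^ c = (- q) ^ d"
  shows "qp ^ c * lift_matrix A q M x i j = qp ^ d * lift_matrix A q M x i j"
proof (rule alg_prod_eqI)
  fix B :: "(complex, 'a) module" and r :: complex
  assume B: "complex_algebra B" and r: "r \<noteq> 0"
  then interpret B: complex_algebra B by simp
  show "component (qp ^ c * lift_matrix A q M x i j) (B, r) =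
      component (qp ^ d * lift_matrix A q M x i j) (B, r)"
    using assms(2) by (auto simp: B.comp_qp_power_mult[OF r] component_lift_matrix[OF B r assms(1)])
qed

section \<open>From the product of all blocks to the determinant\<close>

lemma concat_blocks: "concat (map (\<lambda>i. [m * (i - 1) + 1..<m * i + 1]) [1..<n + 1]) = [1..<m * n + 1]"
proof (induction n)
  case (Suc n)
  have "[1..<m * Suc n + 1] = [1..<(m * n + 1) + m]" by (simp add: add_ac)
  also have "\<dots> = [1..<m * n + 1] @ [m * n + 1..<(m * n + 1) + m]"
    by (rule upt_add_eq_append) simp
  finally show ?case using Suc by (simp add: add_ac)
qed simp

lemma prod_list_concat: "prod_list (concat xss) = prod_list (map prod_list (xss :: 'r::monoid_mult list list))"
  by (induction xss) auto

lemma single_zero: "single A q \<zero>\<^bsub>A\<^esub> = 0"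
  by (rule alg_prod_eqI) (auto simp: component_single component_simps)

text \<open>The added forms are removed one row at a time from the end of the product, which is why
  \<open>diag\<close> and \<open>off_diag\<close> describe the rows after \<open>N\<close>.\<close>

lemma (in complex_algebra) qdet_eq_hyper_pfaffian:
  assumes q: "q \<noteq> 0" "(- q) ^ (m * (m - 1)) = (- q) ^ m" and m: "2 \<le> m"
    and M: "M = m * (n + 1)" "N \<le> M"
    and x: "quantum_matrix A q M x"
    and diag: "\<And>t. t \<in> {N<..M} \<Longrightarrow> x t t = \<one>"
    and off_diag: "\<And>t j. t \<in> {N<..M} \<Longrightarrow> j \<in> {1..M} \<Longrightarrow> j \<noteq> t \<Longrightarrow> x t j = \<zero>"
    and y: "\<And>i j. i \<in> {1..N} \<Longrightarrow> j \<in> {1..N} \<Longrightarrow> y i j = x i j"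
  shows "qdet A q y N = hyper_pfaffian A q m (block_minor_sum A q x m n) n"
proof -
  define a where "a = lift_matrix A q M x"
  define w where "w = (\<lambda>i. row {1..M} (a i))"
  define B where "B = (\<lambda>i. [m * (i - 1) + 1..<m * i + 1])"
  define Bs where "Bs = map B [1..<n + 1 + 1]"
  define \<Omega> where "\<Omega> = map (\<lambda>I. prod_list (map w I)) Bs"
  have a_comp: "component (a i j) (A, q) = x i j" if "i \<in> {1..M}" "j \<in> {1..M}" for i j
    using that component_lift_matrix[OF complex_algebra_axioms q(1) x] by (simp add: a_def)
  have minor: "qminor A q z I J = component (coeff (prod_list (map w I)) (set J)) (A, q)"
    if "set I \<subseteq> {1..M}" "set J \<subseteq> {1..M}" "sorted_wrt (<) J" "length J = length I"
      "\<And>i j. i \<in> set I \<Longrightarrow> j \<in> set J \<Longrightarrow> z i j = x i j" for z I J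
    unfolding w_def using that a_comp
    by (intro qminor_eq_component q(1)) (auto simp: subset_iff)
  have set_B: "k \<in> set (B i) \<longleftrightarrow> m * (i - 1) + 1 \<le> k \<and> k < m * i + 1" for i k
    by (simp only: B_def set_upt atLeastLessThan_iff)
  have sorted_B: "sorted_wrt (<) (B i)" for i
    by (simp only: B_def sorted_wrt_upt)
  have B: "set (B i) \<subseteq> {1..M}" "length (B i) = m" if "i \<in> {1..n + 1}" for i
  proof -
    from that obtain i' where "i = Suc i'" by (cases i) auto
    then show "length (B i) = m" by (simp add: B_def)
    have "m * i \<le> M" using that unfolding M(1) by (intro mult_le_mono2) simp
    moreover have "1 \<le> k \<and> k \<le> m * i" if "k \<in> set (B i)" for k
      using that unfolding set_B by linarith
    ultimately show "set (B i) \<subseteq> {1..M}" by fastforce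
  qed
  have "block_minor_sum A q x m n J = component (coeff (sum_list \<Omega>) (set J)) (A, q)"
    if J: "sorted_wrt (<) J" "set J \<subseteq> {1..M}" "length J = m" for J
  proof -
    have "block_minor_sum A q x m n J =
        (\<Oplus>i\<in>{1..n + 1}. component (coeff (prod_list (map w (B i))) (set J)) (A, q))"
      unfolding block_minor_sum_def B_def[symmetric, THEN fun_cong]
      using J B minor q(1) by (intro add.finprod_cong') auto
    also have "\<dots> = component (\<Sum>i\<in>{1..n + 1}. coeff (prod_list (map w (B i))) (set J)) (A, q)"
      by (rule comp_sum[OF q(1), symmetric])
    also have "{1..n + 1} = set [1..<n + 1 + 1]" by (simp only: set_upt) auto
    also have "(\<Sum>i\<in>set [1..<n + 1 + 1]. coeff (prod_list (map w (B i))) (set J)) =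
        coeff (sum_list \<Omega>) (set J)"
      by (simp only: coeff_sum coeff_sum_list \<Omega>_def Bs_def map_map o_def interv_sum_list_conv_sum_set_nat)
    finally show ?thesis .
  qed
  note block_sum = this
  have ordered: "sorted_wrt (\<lambda>I J. \<forall>i\<in>set I. \<forall>j\<in>set J. i < j) Bs"
    unfolding Bs_def sorted_wrt_map
  proof (rule sorted_wrt_mono_rel[of _ "(<)"])
    fix i i' :: nat assume "i < i'"
    then have "m * i \<le> m * (i' - 1)" by (intro mult_le_mono2) simp
    then show "\<forall>k\<in>set (B i). \<forall>k'\<in>set (B i'). k < k'"
      by (intro ballI) (simp only: set_B, linarith)
  qed (rule sorted_wrt_upt)
  have Bs: "sorted_wrt (<) I \<and> length I = m" if "I \<in> set Bs" for I
  proof -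
    from that obtain i where "I = B i" "i \<in> {1..n + 1}"
      unfolding Bs_def set_map set_upt by fastforce
    then show ?thesis using B(2) sorted_B by simp
  qed
  have power: "qp ^ (m * (m - 1)) * a i j = qp ^ m * a i j" for i j
    unfolding a_def by (rule lift_matrix_power[OF x q(2)])
  define W where "W t = prod_list (map w [1..<t + 1])" for t
  have W_Suc: "W (Suc t) = W t * w (Suc t)" for t
    by (simp add: W_def)
  \<comment> \<open>For t > N the form \<open>w t\<close> is a multiple of the largest generator so
    far; appended on the right, it crosses nothing. The equation is stated in one component because
    the diagonal entry \<open>a t t\<close> is the unit only there.\<close>
  have truncate: "component (coeff (W t) {1..t}) (A, q) = component (coeff (W N) {1..N}) (A, q)"
    if "N \<le> t" "t \<le> M" for t
    using that
  proof (induction t rule: dec_induct)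
    case (step t)
    let ?T = "Suc t"
    have T: "?T \<in> {N<..M}" "?T \<in> {1..M}" using step by auto
    have "a ?T j = 0" if "j \<in> {1..M} - {?T}" for j
      using that T off_diag[OF T(1), of j] by (simp add: a_def lift_matrix_def single_zero)
    then have "row ({1..M} - {?T}) (a ?T) = 0"
      by (simp add: row_def)
    moreover have "insert ?T ({1..M} - {?T}) = {1..M}"
      using T(2) by (rule insert_Diff)
    ultimately have "w ?T = const (a ?T ?T) * gen ?T"
      using row_insert[of "{1..M} - {?T}" ?T "a ?T"] by (simp add: w_def)
    then have "W ?T = W t * const (a ?T ?T) * gen ?T"
      by (simp add: W_Suc mult.assoc)
    moreover have "{k \<in> {1..?T}. ?T < k} = {}" "{1..?T} - {?T} = {1..t}"
      by auto
    ultimately have "coeff (W ?T) {1..?T} = coeff (W t) {1..t} * a ?T ?T"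
      by (simp only: coeff_mult_gen[OF finite_atLeastAtMost] coeff_mult_const) simp
    then have "component (coeff (W ?T) {1..?T}) (A, q) = component (coeff (W t) {1..t}) (A, q)"
      using a_comp[OF T(2) T(2)] diag[OF T(1)] by (simp add: comp[OF q(1)] comp_closed[OF q(1)])
    then show ?case
      using step by simp
  qed simp
  have set_upt_Suc: "set [1..<t + 1] = {1..t}" for t
    by (simp only: set_upt) auto
  have "hyper_bracket A q m (block_minor_sum A q x m n) n [1..<M + 1] =
      component (coeff (esym \<Omega> (Suc n)) (set [1..<M + 1])) (A, q)"
  proof (rule hyper_bracket_eq_component[OF q(1) _ power m Bs ordered _ block_sum])
    show "qmatrix a"
      unfolding a_def by (rule qmatrix_lift_matrix[OF x])
    show "\<Omega> = map (\<lambda>I. prod_list (map (\<lambda>i. row {1..M} (a i)) I)) Bs"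
      unfolding \<Omega>_def w_def ..
    show "sorted_wrt (<) [1..<M + 1]"
      by (rule sorted_wrt_upt)
    show "set [1..<M + 1] \<subseteq> {1..M}"
      unfolding set_upt_Suc ..
    show "length [1..<M + 1] = m * (n + 1)"
      by (simp only: length_upt M(1) add_diff_cancel_right')
  qed
  \<comment> \<open>There are exactly n + 1 blocks, so the degree is the top one.\<close>
  also have "esym \<Omega> (Suc n) = prod_list \<Omega>"
  proof -
    have "length \<Omega> = Suc n"
      by (simp only: \<Omega>_def Bs_def length_map length_upt Suc_eq_plus1 add_diff_cancel_right')
    then show ?thesis
      using esym_length[of \<Omega>] by simp
  qed
  also have "\<dots> = prod_list (map w (concat Bs))"
    by (simp only: \<Omega>_def map_concat prod_list_concat map_map o_def)
  also have "concat Bs = [1..<M + 1]"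
    unfolding Bs_def B_def M(1) by (rule concat_blocks)
  also have "component (coeff (prod_list (map w [1..<M + 1])) (set [1..<M + 1])) (A, q) =
      component (coeff (prod_list (map w [1..<N + 1])) (set [1..<N + 1])) (A, q)"
    unfolding set_upt_Suc W_def[symmetric] using M(2) order.refl by (rule truncate)
  also have "\<dots> = qdet A q y N"
    unfolding qdet_def
  proof (rule minor[symmetric])
    show "set [1..<N + 1] \<subseteq> {1..M}" "set [1..<N + 1] \<subseteq> {1..M}"
      unfolding set_upt_Suc using M(2) by auto
    show "y i j = x i j" if "i \<in> set [1..<N + 1]" "j \<in> set [1..<N + 1]" for i j
      using that unfolding set_upt_Suc by (rule y)
  qed (rule sorted_wrt_upt, rule refl)
  finally show ?thesis
    unfolding hyper_pfaffian_def M(1) ..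
qed

section \<open>The quantum matrix algebra\<close>

text \<open>Both sides run over the ways to cut \<open>w\<close> into three pieces. The product is
  written out so that the equation rewrites the unfolded record.\<close>

lemma free_algebra_mult_assoc:
  fixes f g h :: "'x list \<Rightarrow> complex"
  shows "(\<Sum>i\<le>length w. (\<Sum>j\<le>length (take i w). f (take j (take i w)) * g (drop j (take i w))) * h (drop i w)) =
    (\<Sum>j\<le>length w. f (take j w) * (\<Sum>k\<le>length (drop j w). g (take k (drop j w)) * h (drop k (drop j w))))"
proof -
  let ?T = "\<lambda>j k. f (take j w) * (g (take k (drop j w)) * h (drop (k + j) w))"
  have "(\<Sum>i\<le>length w. (\<Sum>j\<le>length (take i w). f (take j (take i w)) * g (drop j (take i w))) * h (drop i w)) =
      (\<Sum>i\<le>length w. \<Sum>j\<le>i. ?T j (i - j))"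
    by (intro sum.cong refl) (auto simp: sum_distrib_right drop_take min_def mult.assoc intro!: sum.cong)
  also have "\<dots> = (\<Sum>(i, j)\<in>(SIGMA i:{..length w}. {..i}). ?T j (i - j))"
    by (rule sum.Sigma) auto
  also have "\<dots> = (\<Sum>(j, k)\<in>(SIGMA j:{..length w}. {..length w - j}). ?T j k)"
    by (rule sum.reindex_bij_witness[of _ "\<lambda>(j, k). (k + j, j)" "\<lambda>(i, j). (j, i - j)"]) auto
  also have "\<dots> = (\<Sum>j\<le>length w. \<Sum>k\<le>length w - j. ?T j k)"
    by (rule sum.Sigma[symmetric]) auto
  finally show ?thesis
    by (simp add: sum_distrib_left)
qed

lemma free_algebra_mult_closed:
  assumes "f \<in> carrier (free_algebra X)" "g \<in> carrier (free_algebra X)"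
  shows "f \<otimes>\<^bsub>free_algebra X\<^esub> g \<in> carrier (free_algebra X)"
proof -
  let ?p = "f \<otimes>\<^bsub>free_algebra X\<^esub> g"
  have *: "\<exists>u v. w = u @ v \<and> f u \<noteq> 0 \<and> g v \<noteq> 0" if "?p w \<noteq> 0" for w
  proof -
    have "(\<Sum>i\<le>length w. f (take i w) * g (drop i w)) \<noteq> 0"
      using that by (simp add: free_algebra_def)
    then obtain i where "f (take i w) * g (drop i w) \<noteq> 0"
      by (rule sum.not_neutral_contains_not_neutral)
    then show ?thesis
      by (intro exI[of _ "take i w"] exI[of _ "drop i w"]) auto
  qed
  then have "{w. ?p w \<noteq> 0} \<subseteq> (\<lambda>(u, v). u @ v) ` ({u. f u \<noteq> 0} \<times> {v. g v \<noteq> 0})"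
    by fastforce
  moreover have "finite ({u. f u \<noteq> 0} \<times> {v. g v \<noteq> 0})"
    using assms by (simp add: free_algebra_def)
  ultimately have "finite {w. ?p w \<noteq> 0}"
    using finite_surj by blast
  moreover have "set w \<subseteq> X" if nz: "?p w \<noteq> 0" for w
  proof -
    obtain u v where "w = u @ v" "f u \<noteq> 0" "g v \<noteq> 0"
      using *[OF nz] by blast
    then show ?thesis using assms by (auto simp: free_algebra_def)
  qed
  ultimately show ?thesis
    by (simp add: free_algebra_def)
qed

lemma complex_algebra_free_algebra: "complex_algebra (free_algebra X)"
proof -
  let ?F = "free_algebra X"
  have carr_add: "(\<lambda>w. f w + g w) \<in> carrier ?F" if "f \<in> carrier ?F" "g \<in> carrier ?F" for f g
  proof -
    have "{w. f w + g w \<noteq> 0} \<subseteq> {w. f w \<noteq> 0} \<union> {w. g w \<noteq> 0}" by auto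
    then show ?thesis
      using that by (auto simp: free_algebra_def intro: finite_subset)
  qed
  have carr_smult: "(\<lambda>w. c * f w) \<in> carrier ?F" if "f \<in> carrier ?F" for c f
  proof -
    have "{w. c * f w \<noteq> 0} \<subseteq> {w. f w \<noteq> 0}" by auto
    then show ?thesis
      using that by (auto simp: free_algebra_def intro: finite_subset)
  qed
  have abelian: "abelian_group ?F"
  proof (rule abelian_groupI)
    show "x \<oplus>\<^bsub>?F\<^esub> y \<in> carrier ?F" if "x \<in> carrier ?F" "y \<in> carrier ?F" for x y
      using carr_add[OF that] by (simp add: free_algebra_def)
    show "\<exists>y\<in>carrier ?F. y \<oplus>\<^bsub>?F\<^esub> x = \<zero>\<^bsub>?F\<^esub>" if "x \<in> carrier ?F" for x
      using carr_smult[OF that, of "- 1"] by (intro bexI[of _ "\<lambda>w. (- 1) * x w"]) (simp_all add: free_algebra_def)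
  qed (auto simp: free_algebra_def add_ac)
  have monoid: "monoid ?F"
  proof (rule monoidI)
    fix f g h assume "f \<in> carrier ?F"
    have "(\<Sum>i\<le>length w. (if take i w = [] then 1 else 0) * f (drop i w)) =
        (\<Sum>i\<le>length w. if i = 0 then f w else 0)" for w
      by (intro sum.cong) auto
    then show "\<one>\<^bsub>?F\<^esub> \<otimes>\<^bsub>?F\<^esub> f = f"
      by (simp add: free_algebra_def fun_eq_iff)
    have "(\<Sum>i\<le>length w. f (take i w) * (if drop i w = [] then 1 else 0)) =
        (\<Sum>i\<le>length w. if i = length w then f w else 0)" for w
      by (intro sum.cong) auto
    then show "f \<otimes>\<^bsub>?F\<^esub> \<one>\<^bsub>?F\<^esub> = f"
      by (simp add: free_algebra_def fun_eq_iff)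
    show "f \<otimes>\<^bsub>?F\<^esub> g \<otimes>\<^bsub>?F\<^esub> h = f \<otimes>\<^bsub>?F\<^esub> (g \<otimes>\<^bsub>?F\<^esub> h)"
      unfolding free_algebra_def by (simp only: monoid.simps free_algebra_mult_assoc)
  qed (auto simp: free_algebra_mult_closed, simp add: free_algebra_def)
  have "ring ?F"
    by (rule ringI[OF abelian monoid])
      (simp_all add: free_algebra_def fun_eq_iff algebra_simps sum.distrib)
  then show ?thesis
  proof (intro complex_algebra.intro complex_algebra_axioms.intro)
    fix f c assume "f \<in> carrier ?F"
    then show "c \<odot>\<^bsub>?F\<^esub> f \<in> carrier ?F"
      using carr_smult[of f c] by (simp add: free_algebra_def)
  qed (simp_all add: free_algebra_def fun_eq_iff algebra_simps sum_distrib_left)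
qed

lemma quot_algebra_simps:
  "carrier (quot_algebra A I) = a_rcosets\<^bsub>A\<^esub> I"
  "X \<otimes>\<^bsub>quot_algebra A I\<^esub> Y = rcoset_mult A I X Y"
  "\<one>\<^bsub>quot_algebra A I\<^esub> = I +>\<^bsub>A\<^esub> \<one>\<^bsub>A\<^esub>"
  "\<zero>\<^bsub>quot_algebra A I\<^esub> = I"
  "X \<oplus>\<^bsub>quot_algebra A I\<^esub> Y = X <+>\<^bsub>A\<^esub> Y"
  "c \<odot>\<^bsub>quot_algebra A I\<^esub> X = (\<Union>x\<in>X. I +>\<^bsub>A\<^esub> (c \<odot>\<^bsub>A\<^esub> x))"
  by (simp_all add: quot_algebra_def ring.defs module.defs FactRing_def)

text \<open>Extending the record adds a scalar multiplication and leaves the ring operations as they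
  are.\<close>

lemma ring_extend:
  assumes "ring R"
  shows "ring (ring.extend R z)"
proof -
  interpret ring R by fact
  show ?thesis
  proof (intro ringI abelian_groupI monoidI)
    fix x assume "x \<in> carrier (ring.extend R z)"
    then show "\<exists>y\<in>carrier (ring.extend R z). y \<oplus>\<^bsub>ring.extend R z\<^esub> x = \<zero>\<^bsub>ring.extend R z\<^esub>"
      by (intro bexI[of _ "\<ominus>\<^bsub>R\<^esub> x"]) (simp_all add: ring.defs l_neg)
  qed (simp_all add: ring.defs a_ac m_assoc l_distr r_distr)
qed

context complex_algebra
begin

lemma smult_r_distr: "x \<in> carrier A \<Longrightarrow> y \<in> carrier A \<Longrightarrow> c \<odot> (x \<oplus> y) = c \<odot> x \<oplus> c \<odot> y"
  by (simp add: smult_eq[of "x \<oplus> y"] smult_eq[of x] smult_eq[of y] r_distr)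

text \<open>A ring ideal absorbs scalars, because \<open>c\<close> acts as multiplication by the
  multiple \<open>c\<close> of the unit. Hence all members of the union that defines the scalar
  multiple are the same coset.\<close>

lemma smult_coset:
  assumes I: "ideal I A" and x: "x \<in> carrier A"
  shows "c \<odot>\<^bsub>quot_algebra A I\<^esub> (I +> x) = I +> c \<odot> x"
proof -
  interpret I: ideal I A by fact
  have "I +> c \<odot> y = I +> c \<odot> x" if "y \<in> I +> x" for y
  proof -
    obtain h where h: "h \<in> I" "y = h \<oplus> x"
      using \<open>y \<in> I +> x\<close> by (auto simp: a_r_coset_def')
    then have "c \<odot> h \<in> I"
      using I.I_l_closed[of h "c \<odot> \<one>"] I.Icarr by (simp add: smult_eq[of h])
    moreover have "c \<odot> y = c \<odot> h \<oplus> c \<odot> x"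
      using h x I.Icarr by (simp add: smult_r_distr)
    ultimately have "c \<odot> y \<in> I +> c \<odot> x"
      by (auto simp: a_r_coset_def')
    then show ?thesis
      using x by (intro a_repr_independence[symmetric] I.is_additive_subgroup[THEN additive_subgroup.a_subgroup]) auto
  qed
  moreover have "x \<in> I +> x" using x by (rule I.a_rcos_self)
  ultimately show ?thesis
    unfolding quot_algebra_simps by blast
qed

lemma coset_ring_hom:
  assumes I: "ideal I A"
  shows "ring_hom_ring A (quot_algebra A I) ((+>) I)"
proof -
  interpret I: ideal I A by fact
  have "ring (quot_algebra A I)"
    unfolding quot_algebra_def by (intro ring_extend I.quotient_is_ring)
  then show ?thesis
    using I.rcos_ring_hom
    by (intro ring_hom_ringI2 ring_axioms) (auto simp: ring_hom_def quot_algebra_simps FactRing_def)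
qed

lemma complex_algebra_quot_algebra:
  assumes I: "ideal I A"
  shows "complex_algebra (quot_algebra A I)"
proof -
  let ?Q = "quot_algebra A I"
  interpret h: ring_hom_ring A ?Q "(+>) I" by (rule coset_ring_hom[OF I])
  note smult = smult_coset[OF I]
  have rep: "\<exists>x\<in>carrier A. X = I +> x" if "X \<in> carrier ?Q" for X
    using that by (auto simp: quot_algebra_simps A_RCOSETS_def')
  show ?thesis
  proof
    fix X c d assume "X \<in> carrier ?Q"
    then obtain x where x: "x \<in> carrier A" "X = I +> x" using rep by blast
    show "c \<odot>\<^bsub>?Q\<^esub> X \<in> carrier ?Q" "(c + d) \<odot>\<^bsub>?Q\<^esub> X = c \<odot>\<^bsub>?Q\<^esub> X \<oplus>\<^bsub>?Q\<^esub> d \<odot>\<^bsub>?Q\<^esub> X"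
      "(c * d) \<odot>\<^bsub>?Q\<^esub> X = c \<odot>\<^bsub>?Q\<^esub> (d \<odot>\<^bsub>?Q\<^esub> X)" "1 \<odot>\<^bsub>?Q\<^esub> X = X"
      using x by (simp_all add: smult smult_l_distr smult_assoc smult_one)
    fix Y assume "Y \<in> carrier ?Q"
    then obtain y where y: "y \<in> carrier A" "Y = I +> y" using rep by blast
    show "(c \<odot>\<^bsub>?Q\<^esub> X) \<otimes>\<^bsub>?Q\<^esub> Y = c \<odot>\<^bsub>?Q\<^esub> (X \<otimes>\<^bsub>?Q\<^esub> Y)"
      "X \<otimes>\<^bsub>?Q\<^esub> (c \<odot>\<^bsub>?Q\<^esub> Y) = c \<odot>\<^bsub>?Q\<^esub> (X \<otimes>\<^bsub>?Q\<^esub> Y)"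
      using x y by (simp_all add: smult smult_m_left smult_m_right flip: h.hom_mult)
  qed
qed

end

section \<open>The relations for the extended matrix and for the generators\<close>

lemma (in complex_algebra) quantum_matrix_extend_matrix:
  assumes a: "quantum_matrix A q N a"
  shows "quantum_matrix A q M (extend_matrix A N a)"
  unfolding quantum_matrix_def
proof (intro conjI ballI impI)
  let ?x = "extend_matrix A N a"
  have carr: "?x i j \<in> carrier A" if "i \<in> {1..M}" "j \<in> {1..M}" for i j
    using a that by (auto simp: extend_matrix_def quantum_matrix_def)
  then show "?x i j \<in> carrier A" if "i \<in> {1..M}" "j \<in> {1..M}" for i j
    using that .
  have zero: "?x i j = \<zero>" if "i \<noteq> j" "N < i \<or> N < j" for i j
    using that by (auto simp: extend_matrix_def)
  have one: "?x i i = \<one>" if "N < i" for i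
    using that by (simp add: extend_matrix_def)
  have old: "?x i j = a i j" "i \<in> {1..N}" "j \<in> {1..N}"
    if "i \<in> {1..M}" "j \<in> {1..M}" "i \<le> N" "j \<le> N" for i j
    using that by (auto simp: extend_matrix_def)
  {
    fix i k l assume ikl: "i \<in> {1..M}" "k \<in> {1..M}" "l \<in> {1..M}" "k < l"
    show "?x i k \<otimes> ?x i l = q \<odot> (?x i l \<otimes> ?x i k)"
    proof (cases "i \<le> N \<and> l \<le> N")
      case True
      then have "?x i k = a i k" "?x i l = a i l" "i \<in> {1..N}" "k \<in> {1..N}" "l \<in> {1..N}"
        using old ikl by auto
      then show ?thesis
        using a ikl(4) unfolding quantum_matrix_def by metis
    next
      case False
      have "?x i k = \<zero> \<or> ?x i l = \<zero>"
      proof (cases "i = k")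
        case True
        then show ?thesis using False ikl zero[of i l] by auto
      next
        case ik: False
        show ?thesis
        proof (cases "N < i")
          case True
          then show ?thesis using ik zero[of i k] by simp
        next
          case le: False
          then show ?thesis using False zero[of i l] by auto
        qed
      qed
      then show ?thesis
        using carr ikl by auto
    qed
  }
  fix i j k l assume ijkl: "i \<in> {1..M}" "j \<in> {1..M}" "k \<in> {1..M}" "l \<in> {1..M}" "i < j" "k < l"
  note carr' = carr[OF ijkl(1,3)] carr[OF ijkl(1,4)] carr[OF ijkl(2,3)] carr[OF ijkl(2,4)]
  have "?x j k \<otimes> ?x i l = ?x i l \<otimes> ?x j k \<and>
    ?x i k \<otimes> ?x j l \<ominus> ?x j l \<otimes> ?x i k = (q - inverse q) \<odot> (?x i l \<otimes> ?x j k)"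
  proof (cases "j \<le> N \<and> l \<le> N")
    case True
    then have "?x i k = a i k" "?x i l = a i l" "?x j k = a j k" "?x j l = a j l"
      "i \<in> {1..N}" "j \<in> {1..N}" "k \<in> {1..N}" "l \<in> {1..N}"
      using old ijkl by auto
    then show ?thesis
      using a ijkl(5,6) unfolding quantum_matrix_def by metis
  next
    case False
    \<comment> \<open>If j = k, then i < k < l and l exceeds \<open>N\<close>. Otherwise j > N makes
      the entry (j, k) vanish, and l > N >= j > i makes the entry (i, l) vanish.\<close>
    have off: "?x i l = \<zero> \<or> ?x j k = \<zero>"
    proof (cases "j = k")
      case True
      then show ?thesis using False ijkl zero[of i l] by auto
    next
      case jk: False
      show ?thesis
      proof (cases "N < j")
        case True
        then show ?thesis using jk zero[of j k] by simp
      next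
        case le: False
        then show ?thesis using False ijkl zero[of i l] by auto
      qed
    qed
    \<comment> \<open>Outside the old block the entry (j, l) is zero or the unit, so it is central
      and the commutator vanishes.\<close>
    moreover have "?x j l = \<zero> \<or> ?x j l = \<one>"
      using False zero[of j l] one[of j] by (cases "j = l") auto
    then have "?x i k \<otimes> ?x j l \<ominus> ?x j l \<otimes> ?x i k = \<zero>"
      using carr' by (auto simp: a_minus_def r_neg)
    ultimately show ?thesis
      using carr' by auto
  qed
  then show "?x j k \<otimes> ?x i l = ?x i l \<otimes> ?x j k"
    "?x i k \<otimes> ?x j l \<ominus> ?x j l \<otimes> ?x i k = (q - inverse q) \<odot> (?x i l \<otimes> ?x j k)"
    by blast+
qed

lemma free_gen_closed: "x \<in> X \<Longrightarrow> free_gen x \<in> carrier (free_algebra X)"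
  by (auto simp: free_algebra_def free_gen_def)

lemma ideal_qmat_ideal: "ideal (qmat_ideal q N) (free_algebra ({1..N} \<times> {1..N}))"
  and qmat_rels_subset: "qmat_rels q N \<subseteq> qmat_ideal q N"
proof -
  define X where "X = {1..N} \<times> {1..N}"
  interpret F: complex_algebra "free_algebra X" by (rule complex_algebra_free_algebra)
  have gen: "free_gen (i, j) \<in> carrier (free_algebra X)" if "1 \<le> i" "i \<le> N" "1 \<le> j" "j \<le> N" for i j
    using that by (intro free_gen_closed) (simp add: X_def)
  have "qmat_rels q N \<subseteq> carrier (free_algebra X)"
    unfolding qmat_rels_def Let_def X_def[symmetric]
    by (auto intro!: F.minus_closed F.m_closed F.smult_closed gen)
  then show "ideal (qmat_ideal q N) (free_algebra ({1..N} \<times> {1..N}))" "qmat_rels q N \<subseteq> qmat_ideal q N"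
    unfolding qmat_ideal_def X_def[symmetric] by (rule F.genideal_ideal, rule F.genideal_self)
qed

lemma complex_algebra_qmat_algebra: "complex_algebra (qmat_algebra q N)"
  unfolding qmat_algebra_def
  by (intro complex_algebra.complex_algebra_quot_algebra complex_algebra_free_algebra ideal_qmat_ideal)

lemma quantum_matrix_qmat_gen: "quantum_matrix (qmat_algebra q N) q N (qmat_gen q N)"
proof -
  define X where "X = {1..N} \<times> {1..N}"
  let ?F = "free_algebra X" and ?A = "qmat_algebra q N"
    and ?a = "\<lambda>i j. free_gen (i, j) :: (nat \<times> nat) list \<Rightarrow> complex"
  let ?h = "(+>\<^bsub>?F\<^esub>) (qmat_ideal q N)"
  have A: "?A = quot_algebra ?F (qmat_ideal q N)"
    by (simp only: qmat_algebra_def X_def)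
  have ideal: "ideal (qmat_ideal q N) ?F"
    unfolding X_def by (rule ideal_qmat_ideal)
  interpret F: complex_algebra ?F by (rule complex_algebra_free_algebra)
  interpret h: ring_hom_ring ?F ?A ?h
    unfolding A by (rule F.coset_ring_hom[OF ideal])
  have smult: "?h (c \<odot>\<^bsub>?F\<^esub> f) = c \<odot>\<^bsub>?A\<^esub> ?h f" if "f \<in> carrier ?F" for c f
    unfolding A by (rule F.smult_coset[OF ideal that, symmetric])
  have eq: "?h f = ?h g" if "f \<ominus>\<^bsub>?F\<^esub> g \<in> qmat_rels q N" "f \<in> carrier ?F" "g \<in> carrier ?F" for f g
    using that qmat_rels_subset F.quotient_eq_iff_same_a_r_cos[OF ideal] by blast
  have gen: "?a i j \<in> carrier ?F" if "i \<in> {1..N}" "j \<in> {1..N}" for i j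
    using that by (intro free_gen_closed) (simp add: X_def)
  have a: "qmat_gen q N i j = ?h (?a i j)" for i j
    by (simp only: qmat_gen_def X_def)
  show ?thesis
    unfolding quantum_matrix_def
  proof (intro conjI ballI impI)
    show "qmat_gen q N i j \<in> carrier ?A" if "i \<in> {1..N}" "j \<in> {1..N}" for i j
      unfolding a by (rule h.hom_closed[OF gen[OF that]])
  next
    fix i k l assume *: "i \<in> {1..N}" "k \<in> {1..N}" "l \<in> {1..N}" "k < l"
    then have "?a i k \<otimes>\<^bsub>?F\<^esub> ?a i l \<ominus>\<^bsub>?F\<^esub> q \<odot>\<^bsub>?F\<^esub> (?a i l \<otimes>\<^bsub>?F\<^esub> ?a i k) \<in> qmat_rels q N"
      unfolding qmat_rels_def Let_def X_def atLeastAtMost_iff by blast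
    from eq[OF this] show "qmat_gen q N i k \<otimes>\<^bsub>?A\<^esub> qmat_gen q N i l =
        q \<odot>\<^bsub>?A\<^esub> (qmat_gen q N i l \<otimes>\<^bsub>?A\<^esub> qmat_gen q N i k)"
      using gen * by (simp add: a smult)
  next
    fix i j k l assume *: "i \<in> {1..N}" "j \<in> {1..N}" "k \<in> {1..N}" "l \<in> {1..N}" "i < j" "k < l"
    then have "?a j k \<otimes>\<^bsub>?F\<^esub> ?a i l \<ominus>\<^bsub>?F\<^esub> ?a i l \<otimes>\<^bsub>?F\<^esub> ?a j k \<in> qmat_rels q N"
      unfolding qmat_rels_def Let_def X_def atLeastAtMost_iff by blast
    from eq[OF this] show "qmat_gen q N j k \<otimes>\<^bsub>?A\<^esub> qmat_gen q N i l =
        qmat_gen q N i l \<otimes>\<^bsub>?A\<^esub> qmat_gen q N j k"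
      using gen * by (simp add: a)
    have "(?a i k \<otimes>\<^bsub>?F\<^esub> ?a j l \<ominus>\<^bsub>?F\<^esub> ?a j l \<otimes>\<^bsub>?F\<^esub> ?a i k)
          \<ominus>\<^bsub>?F\<^esub> (q - inverse q) \<odot>\<^bsub>?F\<^esub> (?a i l \<otimes>\<^bsub>?F\<^esub> ?a j k) \<in> qmat_rels q N"
      using * unfolding qmat_rels_def Let_def X_def atLeastAtMost_iff by blast
    from eq[OF this] show "qmat_gen q N i k \<otimes>\<^bsub>?A\<^esub> qmat_gen q N j l
          \<ominus>\<^bsub>?A\<^esub> qmat_gen q N j l \<otimes>\<^bsub>?A\<^esub> qmat_gen q N i k =
        (q - inverse q) \<odot>\<^bsub>?A\<^esub> (qmat_gen q N i l \<otimes>\<^bsub>?A\<^esub> qmat_gen q N j k)"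
      using gen * by (simp add: a smult a_minus_def)
  qed
qed

theorem corollary3p6:
  fixes k m n l :: nat and q :: complex
  assumes "k \<ge> 1" and "m = 2 * k" and "n \<ge> 1" and "1 \<le> l" and "l \<le> m - 1"
    and "q \<noteq> 0" and "q ^ (8 * (k choose 2)) = 1"
  shows "let N = m * n + l;
             A = qmat_algebra q N;
             a = qmat_gen q N;
             b = block_minor_sum A q (extend_matrix A N a) m n
         in qdet A q a N = hyper_pfaffian A q m b n"
proof -
  let ?N = "m * n + l"
  interpret complex_algebra "qmat_algebra q ?N" by (rule complex_algebra_qmat_algebra)
  \<comment> \<open>Evenness makes the division by 2 in the binomial coefficient exact.\<close>
  have "even (k * (k - 1))" by (cases k) auto
  then have "8 * (k choose 2) = 4 * (k * (k - 1))"
    by (auto simp: choose_two elim!: evenE)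
  moreover have "m * (m - 1) = m + 4 * (k * (k - 1))"
    using assms(1,2) by (cases k) (auto simp: algebra_simps)
  ultimately have "(- q) ^ (m * (m - 1)) = (- q) ^ m * (- q) ^ (8 * (k choose 2))"
    by (simp only: power_add)
  then have "(- q) ^ (m * (m - 1)) = (- q) ^ m"
    using assms(7) by simp
  moreover have "2 \<le> m" "?N \<le> m * (n + 1)"
    using assms(1,2,4,5) by auto
  ultimately show ?thesis
    unfolding Let_def
    by (intro qdet_eq_hyper_pfaffian[OF assms(6), of m "m * (n + 1)" n ?N])
      (auto intro: quantum_matrix_extend_matrix quantum_matrix_qmat_gen simp: extend_matrix_def)
qed

end
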